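(* Let $R$ be a unique factorization domain with quotient field $Q(R)$, let $f(s)=\frac{a_m}{m^s}+\cdots+\frac{a_n}{n^s}$ be an algebraically primitive Dirichlet polynomial with coefficients in $R$, $a_ma_n\neq0$, and let $p_1,\dots,p_k$ be prime elements of $R$. For each $i=1,\dots,k$ let $q_{i,1},\dots,q_{i,n_i}$ be the relative degrees of all the segments of the Newton log-polygon of $f$ with respect to $p_i$ (listed with repetition), and define $$\mathcal S_{p_i}=S^1_{rd}(m,n)\cap\{q_{i,1}^{j_1}\cdots q_{i,n_i}^{j_{n_i}}: j_1,\dots,j_{n_i}\in\{0,1\}\}.$$ If $\mathcal S_{p_1}\cap\cdots\cap\mathcal S_{p_k}=\emptyset$, then $f$ is irreducible over $Q(R)$.
   Context: Dirichlet polynomials are multiplied by the Dirichlet product $\left(\sum_j\frac{b_j}{j^s}\right)\left(\sum_k\frac{c_k}{k^s}\right)=\sum_i\frac{\sum_{jk=i}b_jc_k}{i^s}$; constant means supported on $\{1\}$; algebraically primitive means indices with nonzero coefficient have gcd $1$; irreducible over $Q(R)$ means not a product of two nonconstant Dirichlet polynomials over $Q(R)$. Newton log-polygon of $f$ w.r.t. prime $p$: the lower convex hull of the points $(\log i,\nu_p(a_i))$, $a_i\ne0$ ($\nu_p$ the $p$-adic valuation), a polygonal line from $(\log m,\nu_p(a_m))$ to $(\log n,\nu_p(a_n))$ whose maximal straight pieces are its edges. A log-integral point is a point $(\log x,y)$ with $x$ a positive integer and $y$ an integer; the log-integral points on an edge divide it into segments (pieces containing no log-integral points other than their endpoints). The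 relative degree of a segment with endpoints $(\log i,\cdot)$, $(\log j,\cdot)$, $i<j$, is $j/i$. $S^1_{rd}(m,n)=\{\frac dc: d\mid n,\ c\mid m,\ 1<\frac dc\le\sqrt{n/m}\}$. *)

theory Defs
  imports "HOL-Analysis.Analysis" "HOL-Computational_Algebra.Computational_Algebra"
begin

(* A Dirichlet polynomial sum_i f(i)/i^s is its coefficient function on the positive
   integers; the dummy value at 0 is fixed to be 0. *)
definition dirichlet_poly :: "(nat \<Rightarrow> 'a::zero) \<Rightarrow> bool" where
  "dirichlet_poly f \<longleftrightarrow> f 0 = 0 \<and> finite {i. f i \<noteq> 0}"

definition dirichlet_mult :: "(nat \<Rightarrow> 'a::comm_semiring_0) \<Rightarrow> (nat \<Rightarrow> 'a) \<Rightarrow> nat \<Rightarrow> 'a" where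
  "dirichlet_mult b c = (\<lambda>i. \<Sum>(j, k) \<in> {(j, k). j > 0 \<and> k > 0 \<and> j * k = i}. b j * c k)"

definition dirichlet_const :: "(nat \<Rightarrow> 'a::zero) \<Rightarrow> bool" where
  "dirichlet_const f \<longleftrightarrow> {i. f i \<noteq> 0} \<subseteq> {1}"

definition algebraically_primitive :: "(nat \<Rightarrow> 'a::zero) \<Rightarrow> bool" where
  "algebraically_primitive f \<longleftrightarrow> Gcd {i. f i \<noteq> 0} = 1"

(* Irreducibility over the coefficient field itself; for f with coefficients in a domain it is
   meant to be applied to the image of f under to_fract. *)
definition dirichlet_irreducible :: "(nat \<Rightarrow> 'a::field) \<Rightarrow> bool" where
  "dirichlet_irreducible f \<longleftrightarrow>
     \<not> (\<exists>g h. dirichlet_poly g \<and> dirichlet_poly h \<and> \<not> dirichlet_const g \<and> \<not> dirichlet_const h \<and>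
              f = dirichlet_mult g h)"

(* The polygonal line itself, as a subset of the plane: the lower boundary of the convex hull. *)
definition newton_log_polygon ::
    "'a::{factorial_semiring, idom} \<Rightarrow> (nat \<Rightarrow> 'a) \<Rightarrow> (real \<times> real) set" where
  "newton_log_polygon p f =
     (let H = convex hull {(ln (real i), real (multiplicity p (f i))) | i. f i \<noteq> 0}
      in {(x, y) \<in> H. \<forall>y'. (x, y') \<in> H \<longrightarrow> y \<le> y'})"

definition polygon_edge :: "(real \<times> real) set \<Rightarrow> (real \<times> real) set \<Rightarrow> bool" where
  "polygon_edge L E \<longleftrightarrow>
     (\<exists>a b. a \<noteq> b \<and> E = closed_segment a b) \<and> E \<subseteq> L \<and>
     (\<forall>c d. E \<subseteq> closed_segment c d \<and> closed_segment c d \<subseteq> L \<longrightarrow> closed_segment c d = E)"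

definition log_point :: "nat \<times> int \<Rightarrow> real \<times> real" where
  "log_point = (\<lambda>(x, y). (ln (real x), real_of_int y))"

definition log_integral_points :: "(real \<times> real) set" where
  "log_integral_points = log_point ` {(x, y). x > 0}"

(* A segment is encoded by the integer data ((i, u), (j, v)), i < j, of its two endpoints
   (log i, u) and (log j, v). *)
definition newton_segments ::
    "'a::{factorial_semiring, idom} \<Rightarrow> (nat \<Rightarrow> 'a) \<Rightarrow> ((nat \<times> int) \<times> (nat \<times> int)) set" where
  "newton_segments p f =
     {(P, Q). 0 < fst P \<and> fst P < fst Q \<and>
        (\<exists>E. polygon_edge (newton_log_polygon p f) E \<and> log_point P \<in> E \<and> log_point Q \<in> E) \<and>
        open_segment (log_point P) (log_point Q) \<inter> log_integral_points = {}}"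

(* The products over newton_segments in S_prime below are therefore genuine finite products. *)
lemma finite_newton_segments:
  assumes "dirichlet_poly f"
  shows "finite (newton_segments p f)"
proof -
  define A where "A = {(ln (real i), real (multiplicity p (f i))) | i. f i \<noteq> 0}"
  define L where "L = newton_log_polygon p f"
  have fin: "finite {i. f i \<noteq> 0}" using assms by (simp add: dirichlet_poly_def)
  have "A = (\<lambda>i. (ln (real i), real (multiplicity p (f i)))) ` {i. f i \<noteq> 0}"
    by (auto simp: A_def)
  with fin have "bounded (convex hull A)"
    by (simp add: finite_imp_bounded bounded_convex_hull)
  then obtain B where B: "\<And>z. z \<in> convex hull A \<Longrightarrow> norm z \<le> B"
    by (auto simp: bounded_iff)
  have L_hull: "z \<in> convex hull A" if "z \<in> L" for z
    using that by (auto simp: L_def newton_log_polygon_def A_def Let_def)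
  have L_unique: "y = y'" if "(x, y) \<in> L" "(x, y') \<in> L" for x y y'
    using that unfolding L_def newton_log_polygon_def Let_def by force
  define D where "D = {P. 0 < fst P \<and> log_point P \<in> L}"
  have inj: "inj_on fst D"
  proof (rule inj_onI)
    fix P Q assume "P \<in> D" "Q \<in> D" "fst P = fst Q"
    then show "P = Q"
      using L_unique[of "ln (real (fst P))" "real_of_int (snd P)" "real_of_int (snd Q)"]
      by (auto simp: D_def log_point_def case_prod_beta prod_eq_iff)
  qed
  have bnd: "fst ` D \<subseteq> {..nat \<lceil>exp B\<rceil>}"
  proof
    fix i assume "i \<in> fst ` D"
    then obtain u where iu: "0 < i" "log_point (i, u) \<in> L" by (auto simp: D_def)
    have "norm (fst (log_point (i, u))) \<le> norm (log_point (i, u))" by (metis norm_fst_le prod.collapse)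
    also have "\<dots> \<le> B" using B L_hull iu by blast
    finally have "ln (real i) \<le> B" by (simp add: log_point_def)
    then have "real i \<le> exp B" using iu by (metis exp_le_cancel_iff exp_ln of_nat_0_less_iff)
    then show "i \<in> {..nat \<lceil>exp B\<rceil>}" by simp linarith
  qed
  have "finite D"
    using inj bnd by (meson finite_atMost finite_imageD finite_subset)
  moreover have "newton_segments p f \<subseteq> D \<times> D"
    by (auto simp: newton_segments_def D_def polygon_edge_def L_def)
  ultimately show ?thesis by (auto intro: finite_subset[where B = "D \<times> D"])
qed

definition relative_degree :: "(nat \<times> int) \<times> (nat \<times> int) \<Rightarrow> real" where
  "relative_degree = (\<lambda>((i, u), (j, v)). real j / real i)"

definition S1_rd :: "nat \<Rightarrow> nat \<Rightarrow> real set" where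
  "S1_rd m n = {real d / real c | d c. d dvd n \<and> c dvd m \<and>
                  1 < real d / real c \<and> real d / real c \<le> sqrt (real n / real m)}"

(* The exponents are indexed by the segments rather than by their relative degrees, so that
   relative degrees count with repetition. *)
definition S_prime ::
    "'a::{factorial_semiring, idom} \<Rightarrow> (nat \<Rightarrow> 'a) \<Rightarrow> nat \<Rightarrow> nat \<Rightarrow> real set" where
  "S_prime p f m n = S1_rd m n \<inter>
     {\<Prod>s\<in>newton_segments p f. relative_degree s ^ e s | e :: _ \<Rightarrow> nat. range e \<subseteq> {0, 1}}"

end

theory Submission
  imports Defs
begin

text \<open>
  For a prime \<open>p\<close> and a slope \<open>l\<close>, the indices \<open>i\<close> minimising \<open>\<nu>\<^sub>p(a\<^sub>i) - l log i\<close> span the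
  edge of slope \<open>l\<close> of the Newton log-polygon. As in Dumas' theorem, the extreme such indices are
  multiplicative, so in a factorisation \<open>f = g h\<close> each edge of the polygon of \<open>f\<close> is a translated edge
  of \<open>g\<close> followed by a translated edge of \<open>h\<close>; the point between the two is log-integral, so
  every segment lies in one of the two parts. Hence the quotient of the extreme indices of \<open>g\<close> is
  the product of the relative degrees of the segments coming from \<open>g\<close>, for every \<open>p\<close>. The factor
  with the smaller quotient puts that quotient into every \<open>S\<close>; the quotients exceed 1 because a
  monomial factor would contradict algebraic primitivity.
\<close>

subsection \<open>Valuations of Dirichlet products\<close>

lemma dirichlet_poly_pos: "dirichlet_poly f \<Longrightarrow> f i \<noteq> 0 \<Longrightarrow> 0 < i"
  by (cases i) (auto simp: dirichlet_poly_def)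

lemma finite_factor_pairs: "finite {(j, k). j > 0 \<and> k > 0 \<and> j * k = (i::nat)}"
proof (rule finite_subset)
  show "{(j, k). j > 0 \<and> k > 0 \<and> j * k = i} \<subseteq> {..i} \<times> {..i}" by auto
qed simp

lemma dirichlet_mult_commute: "dirichlet_mult b c = dirichlet_mult c b"
  unfolding dirichlet_mult_def
proof (rule ext)
  fix i :: nat
  show "(\<Sum>(j, k)\<in>{(j, k). j > 0 \<and> k > 0 \<and> j * k = i}. b j * c k) =
        (\<Sum>(j, k)\<in>{(j, k). j > 0 \<and> k > 0 \<and> j * k = i}. c j * b k)"
    by (rule sum.reindex_bij_witness[where i = prod.swap and j = prod.swap])
       (auto simp: mult.commute)
qed

lemma dirichlet_mult_nonzeroE:
  assumes "dirichlet_mult b c i \<noteq> 0"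
  obtains j k where "j > 0" "k > 0" "j * k = i" "b j \<noteq> 0" "c k \<noteq> 0"
proof -
  obtain z where "z \<in> {(j, k). j > 0 \<and> k > 0 \<and> j * k = i}"
      "(case z of (j, k) \<Rightarrow> b j * c k) \<noteq> 0"
    using assms unfolding dirichlet_mult_def by (rule sum.not_neutral_contains_not_neutral)
  moreover obtain j k where "z = (j, k)" by (cases z)
  ultimately have "j > 0" "k > 0" "j * k = i" "b j * c k \<noteq> 0" by simp_all
  moreover from this(4) have "b j \<noteq> 0" "c k \<noteq> 0" by auto
  ultimately show ?thesis using that by blast
qed

lemma dirichlet_mult_single:
  fixes b c :: "nat \<Rightarrow> 'a::comm_semiring_0"
  assumes "0 < s" "0 < t"
    and single: "\<And>j k. j * k = s * t \<Longrightarrow> b j \<noteq> 0 \<Longrightarrow> c k \<noteq> 0 \<Longrightarrow> j = s \<and> k = t"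
  shows "dirichlet_mult b c (s * t) = b s * c t"
proof -
  have "dirichlet_mult b c (s * t) = (\<Sum>(j, k)\<in>{(s, t)}. b j * c k)"
    unfolding dirichlet_mult_def
  proof (rule sum.mono_neutral_right[OF finite_factor_pairs])
    show "{(s, t)} \<subseteq> {(j, k). j > 0 \<and> k > 0 \<and> j * k = s * t}" using assms by auto
    show "\<forall>z\<in>{(j, k). j > 0 \<and> k > 0 \<and> j * k = s * t} - {(s, t)}.
        (case z of (j, k) \<Rightarrow> b j * c k) = 0"
    proof
      fix z assume z: "z \<in> {(j, k). j > 0 \<and> k > 0 \<and> j * k = s * t} - {(s, t)}"
      obtain j k where jk: "z = (j, k)" by (cases z)
      have "j * k = s * t" "(j, k) \<noteq> (s, t)" using z unfolding jk by simp_all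
      then have "b j = 0 \<or> c k = 0" using single by blast
      then show "(case z of (j, k) \<Rightarrow> b j * c k) = 0" unfolding jk by (metis case_prod_conv mult_zero_left mult_zero_right)
    qed
  qed
  then show ?thesis by simp
qed

text \<open>If every term of the coefficient at \<open>i\<close> had valuation above
  \<open>N\<close>, then \<open>p ^ Suc N\<close> would divide the whole sum, contradicting that
  \<open>N\<close> is its valuation.\<close>

lemma multiplicity_dirichlet_mult_ge:
  fixes G H :: "nat \<Rightarrow> 'a::{factorial_semiring, idom}"
  assumes p: "prime_elem p" and nz: "dirichlet_mult G H i \<noteq> 0"
  obtains j k where "j > 0" "k > 0" "j * k = i" "G j \<noteq> 0" "H k \<noteq> 0"
    "multiplicity p (G j) + multiplicity p (H k) \<le> multiplicity p (dirichlet_mult G H i)"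
proof -
  define N where "N = multiplicity p (dirichlet_mult G H i)"
  have nu: "\<not> is_unit p" using p by simp
  have "\<exists>j k. j > 0 \<and> k > 0 \<and> j * k = i \<and> G j \<noteq> 0 \<and> H k \<noteq> 0 \<and>
      multiplicity p (G j) + multiplicity p (H k) \<le> N"
  proof (rule ccontr)
    assume no: "\<not> ?thesis"
    have "p ^ Suc N dvd dirichlet_mult G H i"
      unfolding dirichlet_mult_def
    proof (rule dvd_sum, clarify)
      fix j k :: nat assume jk: "0 < j" "0 < k" "i = j * k"
      show "p ^ Suc N dvd G j * H k"
      proof (cases "G j = 0 \<or> H k = 0")
        case False
        then have "Suc N \<le> multiplicity p (G j * H k)"
        proof -
          have "\<not> multiplicity p (G j) + multiplicity p (H k) \<le> N" using no jk False by blast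
          then show ?thesis using False p by (simp add: prime_elem_multiplicity_mult_distrib)
        qed
        then show ?thesis by (rule multiplicity_dvd')
      qed auto
    qed
    then have "Suc N \<le> N"
      unfolding N_def using nz nu by (subst (asm) power_dvd_iff_le_multiplicity) auto
    then show False by simp
  qed
  then show ?thesis using that N_def by blast
qed

text \<open>Ultrametric principle: a single term of strictly least valuation cannot be cancelled by
  the others, whose sum \<open>R\<close> is divisible by a higher power of \<open>p\<close>.\<close>

lemma multiplicity_dirichlet_mult_eq:
  fixes G H :: "nat \<Rightarrow> 'a::{factorial_semiring, idom}"
  assumes p: "prime_elem p" and pos: "0 < s" "0 < t" and nz: "G s \<noteq> 0" "H t \<noteq> 0"
    and strict: "\<And>j k. j > 0 \<Longrightarrow> k > 0 \<Longrightarrow> j * k = s * t \<Longrightarrow> G j \<noteq> 0 \<Longrightarrow> H k \<noteq> 0 \<Longrightarrow> (j, k) \<noteq> (s, t) \<Longrightarrow>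
      multiplicity p (G s) + multiplicity p (H t) < multiplicity p (G j) + multiplicity p (H k)"
  shows "dirichlet_mult G H (s * t) \<noteq> 0"
    and "multiplicity p (dirichlet_mult G H (s * t)) = multiplicity p (G s) + multiplicity p (H t)"
proof -
  define N where "N = multiplicity p (G s) + multiplicity p (H t)"
  define X where "X = {(j, k). j > 0 \<and> k > 0 \<and> j * k = s * t}"
  define R where "R = (\<Sum>(j, k)\<in>X - {(s, t)}. G j * H k)"
  have split: "dirichlet_mult G H (s * t) = G s * H t + R"
    unfolding dirichlet_mult_def R_def X_def
    by (subst sum.remove[OF finite_factor_pairs, of "(s, t)"]) (use pos in auto)
  have nu: "\<not> is_unit p" using p by simp
  have N: "multiplicity p (G s * H t) = N"
    using p nz by (simp add: N_def prime_elem_multiplicity_mult_distrib)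
  have R: "p ^ Suc N dvd R"
    unfolding R_def
  proof (rule dvd_sum)
    fix z assume "z \<in> X - {(s, t)}"
    then obtain j k where z: "z = (j, k)" and jk: "(j, k) \<in> X" "(j, k) \<noteq> (s, t)" by (cases z) auto
    have "p ^ Suc N dvd G j * H k"
    proof (cases "G j = 0 \<or> H k = 0")
      case False
      then have "Suc N \<le> multiplicity p (G j * H k)"
        using strict[of j k] jk p by (auto simp: X_def N_def prime_elem_multiplicity_mult_distrib)
      then show ?thesis by (rule multiplicity_dvd')
    qed auto
    then show "p ^ Suc N dvd (case z of (j, k) \<Rightarrow> G j * H k)" by (simp add: z)
  qed
  have "\<not> p ^ Suc N dvd G s * H t"
    using nz nu N by (subst power_dvd_iff_le_multiplicity) auto
  then have nd: "\<not> p ^ Suc N dvd dirichlet_mult G H (s * t)"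
    unfolding split using R dvd_add_left_iff by blast
  moreover have "p ^ N dvd dirichlet_mult G H (s * t)"
    unfolding split
  proof (rule dvd_add)
    show "p ^ N dvd G s * H t" using multiplicity_dvd[of p "G s * H t"] N by simp
    show "p ^ N dvd R" using R by (rule dvd_trans[rotated]) (simp add: le_imp_power_dvd)
  qed
  ultimately show "multiplicity p (dirichlet_mult G H (s * t)) = multiplicity p (G s) + multiplicity p (H t)"
    unfolding N_def by (intro multiplicity_eqI) auto
  show "dirichlet_mult G H (s * t) \<noteq> 0" using nd by auto
qed

subsection \<open>Faces of given slope\<close>

text \<open>The intercept at abscissa 0 of the line of slope \<open>l\<close> through the point with
  index \<open>i\<close>.\<close>

definition height :: "'a::{factorial_semiring, idom} \<Rightarrow> real \<Rightarrow> (nat \<Rightarrow> 'a) \<Rightarrow> nat \<Rightarrow> real" where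
  "height p l f i = real (multiplicity p (f i)) - l * ln (real i)"

text \<open>The indices of the points on the supporting line of slope \<open>l\<close>. It makes
  sense for every slope: where the polygon has no edge of slope \<open>l\<close>, the face is a
  single vertex, so \<open>f\<close> and both factors can be compared at the same
  \<open>l\<close>.\<close>

definition face :: "'a::{factorial_semiring, idom} \<Rightarrow> real \<Rightarrow> (nat \<Rightarrow> 'a) \<Rightarrow> nat set" where
  "face p l f = {i. f i \<noteq> 0 \<and> (\<forall>j. f j \<noteq> 0 \<longrightarrow> height p l f i \<le> height p l f j)}"

lemma face_nonzero: "i \<in> face p l f \<Longrightarrow> f i \<noteq> 0"
  by (simp add: face_def)

lemma face_le: "i \<in> face p l f \<Longrightarrow> f j \<noteq> 0 \<Longrightarrow> height p l f i \<le> height p l f j"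
  by (simp add: face_def)

lemma face_height_eq: "i \<in> face p l f \<Longrightarrow> j \<in> face p l f \<Longrightarrow> height p l f i = height p l f j"
  by (meson antisym face_le face_nonzero)

lemma face_less: "i \<in> face p l f \<Longrightarrow> f j \<noteq> 0 \<Longrightarrow> j \<notin> face p l f \<Longrightarrow> height p l f i < height p l f j"
  unfolding face_def by force

lemma finite_face: "dirichlet_poly f \<Longrightarrow> finite (face p l f)"
  by (auto simp: face_def dirichlet_poly_def elim: rev_finite_subset)

lemma face_nonempty:
  assumes "dirichlet_poly f" "f k \<noteq> 0"
  shows "face p l f \<noteq> {}"
proof -
  let ?S = "{i. f i \<noteq> 0}"
  have S: "finite ?S" "?S \<noteq> {}" using assms by (auto simp: dirichlet_poly_def)
  then have "Min (height p l f ` ?S) \<in> height p l f ` ?S" by (intro Min_in) auto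
  then obtain i where "f i \<noteq> 0" "height p l f i = Min (height p l f ` ?S)" by auto
  then have "i \<in> face p l f" using S by (auto simp: face_def)
  then show ?thesis by blast
qed

text \<open>Adding the two minimality inequalities leaves \<open>(l' - l) * (ln j - ln i)\<close>,
  which must be nonnegative: this is the convexity of the polygon.\<close>

lemma face_mono:
  assumes "dirichlet_poly f" "l < l'" "i \<in> face p l f" "j \<in> face p l' f"
  shows "i \<le> j"
proof -
  have pos: "0 < i" "0 < j" using assms dirichlet_poly_pos face_nonzero by blast+
  have "height p l f i \<le> height p l f j" "height p l' f j \<le> height p l' f i"
    using face_le[OF assms(3) face_nonzero[OF assms(4)]] face_le[OF assms(4) face_nonzero[OF assms(3)]]
    by auto
  then have "0 \<le> (l' - l) * (ln (real j) - ln (real i))"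
    by (simp add: height_def algebra_simps)
  then have "ln (real i) \<le> ln (real j)" using assms(2) by (simp add: zero_le_mult_iff)
  then show ?thesis using pos by simp
qed

lemma height_scale:
  assumes "prime_elem p" "r \<noteq> 0" "f i \<noteq> 0"
  shows "height p l (\<lambda>i. r * f i) i = real (multiplicity p r) + height p l f i"
  using assms by (simp add: height_def prime_elem_multiplicity_mult_distrib)

text \<open>A scalar shifts all heights by the same amount. This absorbs the scalar that arises when
  denominators are cleared.\<close>

lemma face_scale:
  assumes "prime_elem p" "r \<noteq> 0"
  shows "face p l (\<lambda>i. r * f i) = face p l f"
  using assms by (auto simp: face_def height_scale)

lemma height_mult_ln:
  assumes "0 < j" "0 < k"
  shows "height p l G j + height p l H k =
    real (multiplicity p (G j) + multiplicity p (H k)) - l * ln (real (j * k))"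
  using assms by (simp add: height_def ln_mult algebra_simps)

lemma height_mult_le:
  assumes "0 < j" "0 < k" "multiplicity p (G j) + multiplicity p (H k) \<le> multiplicity p (f (j * k))"
  shows "height p l G j + height p l H k \<le> height p l f (j * k)"
proof -
  have "real (multiplicity p (G j) + multiplicity p (H k)) \<le> real (multiplicity p (f (j * k)))"
    using assms(3) by (rule of_nat_mono)
  then show ?thesis unfolding height_mult_ln[OF assms(1,2)] by (simp add: height_def)
qed

text \<open>In any competing pair with the same product at least one member lies off its face, so
  its total height is strictly larger. Hence the term at \<open>(s, t)\<close> survives, and no
  index of the product can lie lower.\<close>

lemma face_mult_mem:
  assumes p: "prime_elem p" and G: "dirichlet_poly G" and H: "dirichlet_poly H"
    and s: "s \<in> face p l G" and t: "t \<in> face p l H"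
    and uniq: "\<And>j k. j \<in> face p l G \<Longrightarrow> k \<in> face p l H \<Longrightarrow> j * k = s * t \<Longrightarrow> j = s \<and> k = t"
  shows "s * t \<in> face p l (dirichlet_mult G H)"
    and "height p l (dirichlet_mult G H) (s * t) = height p l G s + height p l H t"
proof -
  have nz: "G s \<noteq> 0" "H t \<noteq> 0" using face_nonzero[OF s] face_nonzero[OF t] by auto
  have pos: "0 < s" "0 < t" using nz G H by (auto intro: dirichlet_poly_pos)
  have strict: "multiplicity p (G s) + multiplicity p (H t) < multiplicity p (G j) + multiplicity p (H k)"
    if jk: "j > 0" "k > 0" "j * k = s * t" "G j \<noteq> 0" "H k \<noteq> 0" "(j, k) \<noteq> (s, t)" for j k
  proof -
    have "height p l G s + height p l H t < height p l G j + height p l H k"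
    proof (cases "j \<in> face p l G")
      case True
      then have "k \<notin> face p l H" using uniq jk by blast
      then show ?thesis using face_less[OF t] face_le[OF s] jk by (simp add: add_le_less_mono)
    next
      case False
      then show ?thesis using face_le[OF t] face_less[OF s] jk by (simp add: add_less_le_mono)
    qed
    then show ?thesis unfolding height_mult_ln[OF jk(1,2)] height_mult_ln[OF pos] jk(3) by simp
  qed
  have eq: "dirichlet_mult G H (s * t) \<noteq> 0"
    "multiplicity p (dirichlet_mult G H (s * t)) = multiplicity p (G s) + multiplicity p (H t)"
    by (rule multiplicity_dirichlet_mult_eq[where G = G and H = H and s = s and t = t, OF p pos nz], rule strict, assumption+)+
  show ht: "height p l (dirichlet_mult G H) (s * t) = height p l G s + height p l H t"
    unfolding height_mult_ln[OF pos] by (simp add: height_def eq)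
  have "height p l G s + height p l H t \<le> height p l (dirichlet_mult G H) i"
    if i: "dirichlet_mult G H i \<noteq> 0" for i
  proof -
    obtain j k where jk: "j > 0" "k > 0" "j * k = i" "G j \<noteq> 0" "H k \<noteq> 0"
      "multiplicity p (G j) + multiplicity p (H k) \<le> multiplicity p (dirichlet_mult G H i)"
      using multiplicity_dirichlet_mult_ge[OF p i] .
    have "height p l G s + height p l H t \<le> height p l G j + height p l H k"
      using face_le s t jk by (intro add_mono) auto
    also have "\<dots> \<le> height p l (dirichlet_mult G H) i"
      using height_mult_le[OF jk(1,2), where f = "dirichlet_mult G H"] jk(3,6) by simp
    finally show ?thesis .
  qed
  then show "s * t \<in> face p l (dirichlet_mult G H)"
    unfolding face_def using eq(1) ht by auto
qed

text \<open>Some term at \<open>i\<close> has valuation at most that of the coefficient. Its total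
  height is then at most the minimum possible, which forces both of its indices onto their
  faces.\<close>

lemma face_mult_factor:
  assumes p: "prime_elem p"
    and s: "s \<in> face p l G" and t: "t \<in> face p l H"
    and i: "i \<in> face p l (dirichlet_mult G H)"
    and ht: "height p l (dirichlet_mult G H) i = height p l G s + height p l H t"
  obtains j k where "j \<in> face p l G" "k \<in> face p l H" "i = j * k"
proof -
  obtain j k where jk: "j > 0" "k > 0" "j * k = i" "G j \<noteq> 0" "H k \<noteq> 0"
    "multiplicity p (G j) + multiplicity p (H k) \<le> multiplicity p (dirichlet_mult G H i)"
    using multiplicity_dirichlet_mult_ge[OF p face_nonzero[OF i]] .
  have "height p l G j + height p l H k \<le> height p l (dirichlet_mult G H) i"
    using height_mult_le[OF jk(1,2), where f = "dirichlet_mult G H"] jk(3,6) by simp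
  then have "\<not> height p l G s + height p l H t < height p l G j + height p l H k" using ht by simp
  then have "j \<in> face p l G" "k \<in> face p l H"
    using face_less[OF s jk(4)] face_less[OF t jk(5)] face_le[OF s jk(4)] face_le[OF t jk(5)]
    by fastforce+
  then show ?thesis using that jk(3) by blast
qed

lemma mult_eq_min:
  fixes s t j k :: nat
  assumes "0 < s" "0 < t" "s \<le> j" "t \<le> k" "j * k = s * t"
  shows "j = s \<and> k = t"
proof (rule ccontr)
  assume "\<not> ?thesis"
  then have "s < j \<or> t < k" using assms by auto
  then have "s * t < j * k"
    using assms by (metis mult_less_le_imp_less mult_le_less_imp_less bot_nat_0.extremum)
  then show False using assms by simp
qed

lemma mult_eq_max:
  fixes s t j k :: nat
  assumes "0 < j" "0 < k" "j \<le> s" "k \<le> t" "j * k = s * t"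
  shows "j = s \<and> k = t"
  using mult_eq_min[of j k s t] assms by simp

text \<open>The pair of least face indices, and likewise the pair of greatest ones, is determined by
  its product, so \<open>face_mult_mem\<close> applies to both. Every other face index of the
  product factors into face indices and so lies between these two.\<close>

lemma
  assumes p: "prime_elem p" and G: "dirichlet_poly G" "G \<noteq> (\<lambda>_. 0)" and H: "dirichlet_poly H" "H \<noteq> (\<lambda>_. 0)"
  shows Min_face_mult: "Min (face p l (dirichlet_mult G H)) = Min (face p l G) * Min (face p l H)"
    and Max_face_mult: "Max (face p l (dirichlet_mult G H)) = Max (face p l G) * Max (face p l H)"
    and Min_height_mult: "height p l (dirichlet_mult G H) (Min (face p l (dirichlet_mult G H))) =
      height p l G (Min (face p l G)) + height p l H (Min (face p l H))"
proof -
  let ?F = "dirichlet_mult G H"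
  note fin = finite_face[OF G(1), of p l] finite_face[OF H(1), of p l]
  have ne: "face p l G \<noteq> {}" "face p l H \<noteq> {}" using face_nonempty G H by blast+
  have pos: "0 < j" if "j \<in> face p l G \<or> j \<in> face p l H" for j
    using that face_nonzero dirichlet_poly_pos G H by blast
  define a b A B where "a = Min (face p l G)" and "b = Min (face p l H)"
    and "A = Max (face p l G)" and "B = Max (face p l H)"
  have mem: "a \<in> face p l G" "b \<in> face p l H" "A \<in> face p l G" "B \<in> face p l H"
    using fin ne by (auto simp: a_def b_def A_def B_def)
  have bnd: "a \<le> j" "j \<le> A" if "j \<in> face p l G" for j
    using that fin by (auto simp: a_def A_def)
  have bnd': "b \<le> j" "j \<le> B" if "j \<in> face p l H" for j
    using that fin by (auto simp: b_def B_def)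
  have min: "a * b \<in> face p l ?F" "height p l ?F (a * b) = height p l G a + height p l H b"
    by (rule face_mult_mem[OF p G(1) H(1) mem(1,2)],
        rule mult_eq_min, use pos mem bnd bnd' in auto)+
  have max: "A * B \<in> face p l ?F"
    by (rule face_mult_mem[OF p G(1) H(1) mem(3,4)],
        rule mult_eq_max, use pos mem bnd bnd' in auto)
  have fac: "\<exists>j k. j \<in> face p l G \<and> k \<in> face p l H \<and> i = j * k" if "i \<in> face p l ?F" for i
    using face_mult_factor[OF p mem(1,2) that] min face_height_eq[OF that min(1)] by metis
  have bounds: "a * b \<le> i \<and> i \<le> A * B" if "i \<in> face p l ?F" for i
    using fac[OF that] bnd bnd' by (auto intro!: mult_le_mono)
  then have finF: "finite (face p l ?F)" by (meson finite_atMost finite_subset subsetI atMost_iff)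
  show "Min (face p l ?F) = Min (face p l G) * Min (face p l H)"
    unfolding a_def[symmetric] b_def[symmetric] using finF min bounds by (intro Min_eqI) auto
  then show "height p l ?F (Min (face p l ?F)) = height p l G (Min (face p l G)) + height p l H (Min (face p l H))"
    using min unfolding a_def b_def by simp
  show "Max (face p l ?F) = Max (face p l G) * Max (face p l H)"
    unfolding A_def[symmetric] B_def[symmetric] using finF max bounds by (intro Max_eqI) auto
qed

subsection \<open>The polygon and its supporting lines\<close>

abbreviation newton_hull :: "'a::{factorial_semiring, idom} \<Rightarrow> (nat \<Rightarrow> 'a) \<Rightarrow> (real \<times> real) set" where
  "newton_hull p f \<equiv> convex hull {(ln (real i), real (multiplicity p (f i))) | i. f i \<noteq> 0}"

lemma polygon_iff:
  "(x, y) \<in> newton_log_polygon p f \<longleftrightarrow>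
     (x, y) \<in> newton_hull p f \<and> (\<forall>y'. (x, y') \<in> newton_hull p f \<longrightarrow> y \<le> y')"
  by (simp add: newton_log_polygon_def Let_def)

lemma polygon_unique:
  "(x, y) \<in> newton_log_polygon p f \<Longrightarrow> (x, y') \<in> newton_log_polygon p f \<Longrightarrow> y = y'"
  by (meson polygon_iff antisym)

text \<open>The open half-plane above the supporting line, together with the stretch of the line
  spanned by the face, is convex and contains all the points of \<open>f\<close>.\<close>

lemma newton_hull_above:
  assumes f: "dirichlet_poly f" and k: "k \<in> face p l f" and xy: "(x, y) \<in> newton_hull p f"
  shows "height p l f k < y - l * x \<or>
    height p l f k = y - l * x \<and> ln (real (Min (face p l f))) \<le> x \<and> x \<le> ln (real (Max (face p l f)))"
proof -
  let ?h = "height p l f k" let ?I = "{ln (real (Min (face p l f)))..ln (real (Max (face p l f)))}"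
  let ?C = "{z. ?h < snd z - l * fst z \<or> ?h = snd z - l * fst z \<and> fst z \<in> ?I}"
  have "newton_hull p f \<subseteq> ?C"
  proof (rule hull_minimal)
    show "convex ?C"
    proof (rule convexI)
      fix a b :: "real \<times> real" and u v :: real
      assume ab: "a \<in> ?C" "b \<in> ?C" and uv: "0 \<le> u" "0 \<le> v" "u + v = 1"
      let ?z = "u *\<^sub>R a + v *\<^sub>R b"
      show "?z \<in> ?C"
      \<comment> \<open>The strict excess of one end over the line passes to \<open>?z\<close> only
        if that end has positive weight.\<close>
      proof (cases "u = 0 \<or> v = 0")
        case True
        then show ?thesis using ab uv by auto
      next
        case False
        then have pos: "0 < u" "0 < v" using uv by auto
        have z: "snd ?z - l * fst ?z - ?h =
            u * (snd a - l * fst a - ?h) + v * (snd b - l * fst b - ?h)"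
        proof -
          have v: "v = 1 - u" using uv(3) by simp
          show ?thesis unfolding v by (simp add: algebra_simps)
        qed
        have ge: "0 \<le> snd a - l * fst a - ?h" "0 \<le> snd b - l * fst b - ?h" using ab by auto
        show ?thesis
        proof (cases "?h = snd a - l * fst a \<and> ?h = snd b - l * fst b")
          case True
          then have "fst a \<in> ?I" "fst b \<in> ?I" using ab by auto
          then have "u *\<^sub>R fst a + v *\<^sub>R fst b \<in> ?I" using uv by (intro convexD) auto
          then show ?thesis using True z by auto
        next
          case False
          then have "0 < snd a - l * fst a - ?h \<or> 0 < snd b - l * fst b - ?h" using ge by auto
          then have "0 < snd ?z - l * fst ?z - ?h"
            unfolding z using ge pos by (auto intro: add_pos_nonneg add_nonneg_pos)
          then show ?thesis by simp
        qed
      qed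
    qed
    show "{(ln (real i), real (multiplicity p (f i))) | i. f i \<noteq> 0} \<subseteq> ?C"
    proof
      fix z assume "z \<in> {(ln (real i), real (multiplicity p (f i))) | i. f i \<noteq> 0}"
      then obtain i where z: "z = (ln (real i), real (multiplicity p (f i)))" and i: "f i \<noteq> 0" by blast
      have h: "snd z - l * fst z = height p l f i" by (simp add: z height_def)
      show "z \<in> ?C"
      proof (cases "i \<in> face p l f")
        case True
        then have "Min (face p l f) \<le> i" "i \<le> Max (face p l f)" "Min (face p l f) \<in> face p l f"
          using finite_face[OF f] by (auto intro!: Min_in)
        moreover from this have "0 < Min (face p l f)" using f face_nonzero dirichlet_poly_pos by blast
        ultimately have "fst z \<in> ?I" using dirichlet_poly_pos[OF f i] by (auto simp: z)
        then show ?thesis using face_height_eq[OF k True] h by simp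
      next
        case False
        then show ?thesis using face_less[OF k i] h by simp
      qed
    qed
  qed
  then show ?thesis using xy by auto
qed

text \<open>A point between two points of the face is a convex combination of them, and nothing in
  the hull lies below the supporting line.\<close>

lemma face_line_in_polygon:
  assumes f: "dirichlet_poly f" and i: "i \<in> face p l f" and j: "j \<in> face p l f"
    and x: "ln (real i) \<le> x" "x \<le> ln (real j)"
  shows "(x, height p l f i + l * x) \<in> newton_log_polygon p f"
  unfolding polygon_iff
proof (intro conjI allI impI)
  let ?P = "\<lambda>i. (ln (real i), real (multiplicity p (f i)))"
  have "x \<in> closed_segment (ln (real i)) (ln (real j))"
    using x by (simp add: closed_segment_eq_real_ivl)
  then obtain u where u: "0 \<le> u" "u \<le> 1" "x = (1 - u) * ln (real i) + u * ln (real j)"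
    by (auto simp: in_segment)
  have hij: "height p l f j = height p l f i" using face_height_eq[OF j i] .
  have mi: "real (multiplicity p (f i)) = height p l f i + l * ln (real i)" by (simp add: height_def)
  have mj: "real (multiplicity p (f j)) = height p l f i + l * ln (real j)"
    using hij by (simp add: height_def)
  have "(x, height p l f i + l * x) = (1 - u) *\<^sub>R ?P i + u *\<^sub>R ?P j"
    unfolding mi mj u(3) by (simp add: algebra_simps)
  also have "\<dots> \<in> newton_hull p f"
    using i j face_nonzero u by (intro convexD_alt[OF convex_convex_hull] hull_inc) blast+
  finally show "(x, height p l f i + l * x) \<in> newton_hull p f" .
  show "height p l f i + l * x \<le> y'" if "(x, y') \<in> newton_hull p f" for y'
    using newton_hull_above[OF f i that] by linarith
qed

text \<open>The content is maximality. On a larger segment inside the polygon the excess over the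
  supporting line is affine and nonnegative, and it vanishes at the two distinct ends of the face.
  So it vanishes at the ends of the larger segment, and \<open>newton_hull_above\<close> puts these
  back into the stretch.\<close>

lemma polygon_edge_face:
  assumes f: "dirichlet_poly f" "f k \<noteq> 0" and lt: "Min (face p l f) < Max (face p l f)"
  shows "polygon_edge (newton_log_polygon p f)
    {(x, y). ln (real (Min (face p l f))) \<le> x \<and> x \<le> ln (real (Max (face p l f))) \<and>
             y = height p l f (Min (face p l f)) + l * x}" (is "polygon_edge ?L ?E")
proof -
  let ?i = "Min (face p l f)" and ?j = "Max (face p l f)"
  let ?h = "height p l f ?i"
  have "face p l f \<noteq> {}" by (rule face_nonempty[OF f])
  then have mem: "?i \<in> face p l f" "?j \<in> face p l f" using finite_face[OF f(1)] by auto
  then have pos: "0 < ?i" "0 < ?j" using f face_nonzero dirichlet_poly_pos by blast+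
  then have lnlt: "ln (real ?i) < ln (real ?j)" using lt by simp
  let ?a = "(ln (real ?i), ?h + l * ln (real ?i))" and ?b = "(ln (real ?j), ?h + l * ln (real ?j))"
  have E: "?E = closed_segment ?a ?b"
  proof (intro equalityI subsetI)
    fix z assume "z \<in> ?E"
    then obtain x where z: "z = (x, ?h + l * x)" "ln (real ?i) \<le> x" "x \<le> ln (real ?j)" by auto
    then have "x \<in> closed_segment (ln (real ?i)) (ln (real ?j))"
      by (simp add: closed_segment_eq_real_ivl)
    then obtain u where u: "0 \<le> u" "u \<le> 1" "x = (1 - u) * ln (real ?i) + u * ln (real ?j)"
      by (auto simp: in_segment)
    have "z = (1 - u) *\<^sub>R ?a + u *\<^sub>R ?b" by (simp add: z(1) u(3) algebra_simps)
    then show "z \<in> closed_segment ?a ?b" using u by (auto simp: in_segment)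
  next
    fix z assume "z \<in> closed_segment ?a ?b"
    then obtain u where u: "0 \<le> u" "u \<le> 1" "z = (1 - u) *\<^sub>R ?a + u *\<^sub>R ?b" by (auto simp: in_segment)
    have "(1 - u) * ln (real ?i) + u * ln (real ?j) \<in> closed_segment (ln (real ?i)) (ln (real ?j))"
      using u by (auto simp: in_segment)
    then show "z \<in> ?E" using lnlt unfolding u(3)
      by (simp add: closed_segment_eq_real_ivl algebra_simps)
  qed
  have EL: "?E \<subseteq> ?L" using face_line_in_polygon[OF f(1) mem] by auto
  have onE: "z \<in> ?E" if "z \<in> ?L" "snd z - l * fst z = ?h" for z
    using newton_hull_above[OF f(1) mem(1), of "fst z" "snd z"] that polygon_iff[of "fst z" "snd z" p f]
    by (auto simp: case_prod_beta)
  have geL: "0 \<le> snd z - l * fst z - ?h" if "z \<in> ?L" for z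
    using newton_hull_above[OF f(1) mem(1), of "fst z" "snd z"] that polygon_iff[of "fst z" "snd z" p f]
    by auto
  have "closed_segment c d = ?E" if sub: "?E \<subseteq> closed_segment c d" "closed_segment c d \<subseteq> ?L" for c d
  proof -
    let ?F = "\<lambda>z. snd z - l * fst z - ?h"
    have Fc: "0 \<le> ?F c" "0 \<le> ?F d" using geL sub by (meson ends_in_segment subsetD)+
    obtain u where u: "0 \<le> u" "u \<le> 1" "?a = (1 - u) *\<^sub>R c + u *\<^sub>R d"
      using sub(1) lnlt unfolding E by (meson ends_in_segment in_segment(1) subsetD)
    obtain v where v: "0 \<le> v" "v \<le> 1" "?b = (1 - v) *\<^sub>R c + v *\<^sub>R d"
      using sub(1) lnlt unfolding E by (meson ends_in_segment in_segment(1) subsetD)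
    have Fw: "?F ((1 - w) *\<^sub>R c + w *\<^sub>R d) = (1 - w) * ?F c + w * ?F d" for w
      by (simp add: algebra_simps)
    have Fu: "(1 - u) * ?F c + u * ?F d = 0" using Fw[of u] unfolding u(3)[symmetric] by simp
    have Fv: "(1 - v) * ?F c + v * ?F d = 0" using Fw[of v] unfolding v(3)[symmetric] by simp
    have "u \<noteq> v"
    proof
      assume "u = v"
      then have "?a = ?b" using u(3) v(3) by metis
      then show False using lnlt by simp
    qed
    \<comment> \<open>A vanishing sum of nonnegative terms has vanishing terms; applied at two
      distinct parameters \<open>u\<close> and \<open>v\<close> it kills the excess at both
      ends.\<close>
    have zero: "(1 - w) * ?F c = 0 \<and> w * ?F d = 0"
      if "0 \<le> w" "w \<le> 1" "(1 - w) * ?F c + w * ?F d = 0" for w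
      using that Fc by (subst (asm) add_nonneg_eq_0_iff) auto
    have "?F c = 0" "?F d = 0"
      using zero[OF u(1,2) Fu] zero[OF v(1,2) Fv] \<open>u \<noteq> v\<close> by auto
    then have "c \<in> ?E" "d \<in> ?E" using onE sub by (force intro!: onE)+
    then have "closed_segment c d \<subseteq> ?E" unfolding E by (simp add: closed_segment_subset)
    then show ?thesis using sub by auto
  qed
  moreover have "?a \<noteq> ?b" using lnlt by simp
  ultimately show ?thesis unfolding polygon_edge_def using E EL by blast
qed

text \<open>Among the finitely many chords from an index at most \<open>t\<close> to an index above
  \<open>t\<close>, the one passing lowest over a fixed abscissa between them lies on a supporting
  line: a point below that line would yield a lower chord.\<close>

lemma supporting_face:
  assumes f: "dirichlet_poly f" and i0: "f i0 \<noteq> 0" "i0 \<le> t" and j0: "f j0 \<noteq> 0" "t < j0"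
  obtains l i j where "i \<in> face p l f" "j \<in> face p l f" "i \<le> t" "t < j"
proof -
  define X where "X = (\<lambda>i::nat. ln (real i))"
  define w where "w = (\<lambda>i. real (multiplicity p (f i)))"
  \<comment> \<open>The shift by \<open>1 / 2\<close> puts \<open>x0\<close> strictly between the
    logarithms of \<open>t\<close> and \<open>t + 1\<close>, so every chord crosses it in its
    interior.\<close>
  define x0 where "x0 = ln (real t + 1 / 2)"
  \<comment> \<open>the ordinate at \<open>x0\<close> of the chord through the points with indices \<open>i\<close> and \<open>j\<close>\<close>
  define c where "c = (\<lambda>(i, j). (w i * (X j - x0) + w j * (x0 - X i)) / (X j - X i))"
  define A where "A = {i. f i \<noteq> 0 \<and> i \<le> t}"
  define B where "B = {i. f i \<noteq> 0 \<and> t < i}"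
  have fin: "finite (A \<times> B)" using f by (auto simp: A_def B_def dirichlet_poly_def)
  have ne: "A \<times> B \<noteq> {}" using i0 j0 by (auto simp: A_def B_def)
  have XA: "X i < x0" if "i \<in> A" for i
    using that dirichlet_poly_pos[OF f, of i] by (auto simp: A_def X_def x0_def)
  have XB: "x0 < X i" if "i \<in> B" for i
    using that by (auto simp: B_def X_def x0_def)
  have "Min (c ` (A \<times> B)) \<in> c ` (A \<times> B)" using fin ne by (intro Min_in) auto
  then obtain i j where ij: "i \<in> A" "j \<in> B" "c (i, j) = Min (c ` (A \<times> B))" by auto
  have cmin: "c (i, j) \<le> c (i', j')" if "i' \<in> A" "j' \<in> B" for i' j'
    using ij(3) fin that by auto
  define l where "l = (w j - w i) / (X j - X i)"
  define e where "e = w i - l * X i"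
  have lt: "X i < X j" using XA[OF ij(1)] XB[OF ij(2)] by simp
  have ej: "w j - l * X j = e"
  proof -
    have "l * (X j - X i) = w j - w i" using lt by (simp add: l_def)
    then show ?thesis by (simp add: e_def algebra_simps)
  qed
  \<comment> \<open>The excess of a chord over the line of slope \<open>l\<close> at
    \<open>x0\<close> is the weighted mean of the excesses at its two ends.\<close>
  have key: "c (a, b) - (e + l * x0) =
      ((w a - l * X a - e) * (X b - x0) + (w b - l * X b - e) * (x0 - X a)) / (X b - X a)"
    if "X a < X b" for a b
    using that by (simp add: c_def field_simps)
  have cij: "c (i, j) = e + l * x0" using key[OF lt] ej by (simp add: e_def)
  have above: "e \<le> w k - l * X k" if k: "f k \<noteq> 0" for k
  proof (rule ccontr)
    assume "\<not> ?thesis"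
    then have neg: "w k - l * X k - e < 0" by simp
    show False
    proof (cases "k \<le> t")
      case True
      then have kA: "k \<in> A" using k by (simp add: A_def)
      have lt': "X k < X j" using XA[OF kA] XB[OF ij(2)] by simp
      have "(w k - l * X k - e) * (X j - x0) < 0" using neg XB[OF ij(2)] by (simp add: mult_neg_pos)
      then have "c (k, j) - (e + l * x0) < 0" unfolding key[OF lt'] ej using lt' by (simp add: divide_neg_pos)
      then show False using cmin[OF kA ij(2)] cij by simp
    next
      case False
      then have kB: "k \<in> B" using k by (simp add: B_def)
      have lt': "X i < X k" using XA[OF ij(1)] XB[OF kB] by simp
      have "(w k - l * X k - e) * (x0 - X i) < 0" using neg XA[OF ij(1)] by (simp add: mult_neg_pos)
      then have "c (i, k) - (e + l * x0) < 0"
        unfolding key[OF lt'] using lt' by (simp add: e_def[symmetric] divide_neg_pos)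
      then show False using cmin[OF ij(1) kB] cij by simp
    qed
  qed
  have ht: "height p l f k = w k - l * X k" for k by (simp add: height_def w_def X_def)
  have "i \<in> face p l f" "j \<in> face p l f"
    using ij above ej by (auto simp: face_def ht A_def B_def e_def[symmetric])
  then show ?thesis using that ij by (auto simp: A_def B_def)
qed

subsection \<open>Segments as gaps between log-integral points\<close>

text \<open>Log-integral points of the polygon, recorded by the integer under the logarithm alone;
  the ordinate is recovered from it because the polygon is a graph.\<close>

definition knots :: "'a::{factorial_semiring, idom} \<Rightarrow> (nat \<Rightarrow> 'a) \<Rightarrow> nat set" where
  "knots p f = {x. 0 < x \<and> (\<exists>u. log_point (x, u) \<in> newton_log_polygon p f)}"

text \<open>Pairs of consecutive elements; for \<open>knots\<close> they correspond to the
  segments.\<close>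

definition gaps :: "'b::linorder set \<Rightarrow> ('b \<times> 'b) set" where
  "gaps X = {(x, y). x \<in> X \<and> y \<in> X \<and> x < y \<and> (\<forall>z\<in>X. z \<le> x \<or> y \<le> z)}"

text \<open>A telescoping product: adjoining a new maximum \<open>b\<close> creates exactly one new
  gap, from the old maximum to \<open>b\<close>.\<close>

lemma prod_gaps:
  fixes \<alpha> :: "'b::linorder \<Rightarrow> 'c::field"
  assumes "finite X" "X \<noteq> {}" "\<And>x. x \<in> X \<Longrightarrow> \<alpha> x \<noteq> 0"
  shows "(\<Prod>(x, y)\<in>gaps X. \<alpha> y / \<alpha> x) = \<alpha> (Max X) / \<alpha> (Min X)"
  using assms
proof (induction X rule: finite_linorder_max_induct)
  case empty
  then show ?case by simp
next
  case (insert b A)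
  show ?case
  proof (cases "A = {}")
    case True
    then have "gaps (insert b A) = {}" by (auto simp: gaps_def)
    then show ?thesis using True insert.prems by simp
  next
    case False
    have MA: "Max A \<in> A" "\<And>z. z \<in> A \<Longrightarrow> z \<le> Max A" using insert.hyps False by auto
    have g: "gaps (insert b A) = insert (Max A, b) (gaps A)"
    proof (intro equalityI subsetI)
      fix z assume "z \<in> gaps (insert b A)"
      then obtain x y where z: "z = (x, y)" "x \<in> insert b A" "y \<in> insert b A" "x < y"
        "\<forall>z\<in>insert b A. z \<le> x \<or> y \<le> z" by (auto simp: gaps_def)
      have "x \<in> A" using z insert.hyps(2) by (metis insert_iff less_asym)
      show "z \<in> insert (Max A, b) (gaps A)"
      proof (cases "y = b")
        case True
        then have "Max A \<le> x" using z(5) MA(1) insert.hyps(2) by (meson insertI2 leD)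
        then have "x = Max A" using MA(2)[OF \<open>x \<in> A\<close>] by simp
        then show ?thesis using True z by simp
      next
        case False
        then show ?thesis using z \<open>x \<in> A\<close> by (auto simp: gaps_def)
      qed
    next
      fix z assume "z \<in> insert (Max A, b) (gaps A)"
      then show "z \<in> gaps (insert b A)"
        using MA insert.hyps(2) by (auto simp: gaps_def less_imp_le)
    qed
    have "finite (gaps A)"
      by (rule finite_subset[of _ "A \<times> A"]) (use insert.hyps in \<open>auto simp: gaps_def\<close>)
    moreover have "(Max A, b) \<notin> gaps A" using insert.hyps(2) by (auto simp: gaps_def)
    ultimately have "(\<Prod>(x, y)\<in>gaps (insert b A). \<alpha> y / \<alpha> x) = (\<alpha> b / \<alpha> (Max A)) * (\<alpha> (Max A) / \<alpha> (Min A))"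
      unfolding g using insert.IH insert.prems False by simp
    also have "\<dots> = \<alpha> b / \<alpha> (Min A)" using insert.prems MA(1) by simp
    finally have prod: "(\<Prod>(x, y)\<in>gaps (insert b A). \<alpha> y / \<alpha> x) = \<alpha> b / \<alpha> (Min A)" .
    have "Max (insert b A) = b" using insert.hyps by (intro Max_eqI) (auto simp: less_imp_le)
    moreover have "Min (insert b A) = Min A"
    proof (rule Min_eqI)
      have "Min A \<in> A" using insert.hyps(1) False by simp
      then show "Min A \<in> insert b A" by simp
      show "Min A \<le> y" if "y \<in> insert b A" for y
        using that insert.hyps \<open>Min A \<in> A\<close> by (auto simp: less_imp_le)
    qed (use insert.hyps in simp)
    ultimately show ?thesis using prod by simp
  qed
qed

text \<open>The vertical strip over the interval from \<open>ln m\<close> to \<open>ln n\<close> is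
  convex and contains all the points of \<open>f\<close>, hence their hull.\<close>

lemma knots_bounds:
  assumes f: "dirichlet_poly f" and nz: "f m \<noteq> 0" "f n \<noteq> 0"
    and mn: "\<And>i. f i \<noteq> 0 \<Longrightarrow> m \<le> i \<and> i \<le> n" and x: "x \<in> knots p f"
  shows "m \<le> x" "x \<le> n"
proof -
  have pos: "0 < m" "0 < n" using dirichlet_poly_pos[OF f] nz by auto
  have "newton_hull p f \<subseteq> {ln (real m)..ln (real n)} \<times> UNIV"
  proof (rule hull_minimal)
    show "{(ln (real i), real (multiplicity p (f i))) | i. f i \<noteq> 0} \<subseteq> {ln (real m)..ln (real n)} \<times> UNIV"
      using mn dirichlet_poly_pos[OF f] pos by auto
  qed (intro convex_Times convex_UNIV convex_real_interval)
  moreover obtain u where "(ln (real x), real_of_int u) \<in> newton_hull p f" "0 < x"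
    using x by (auto simp: knots_def log_point_def polygon_iff)
  ultimately have "ln (real m) \<le> ln (real x)" "ln (real x) \<le> ln (real n)" by auto
  then show "m \<le> x" "x \<le> n" using pos \<open>0 < x\<close> by auto
qed

lemma knots_face:
  assumes f: "dirichlet_poly f" and i: "i \<in> face p l f"
  shows "i \<in> knots p f"
proof -
  have "(ln (real i), height p l f i + l * ln (real i)) \<in> newton_log_polygon p f"
    by (rule face_line_in_polygon[OF f i i]) auto
  then have "log_point (i, int (multiplicity p (f i))) \<in> newton_log_polygon p f"
    by (simp add: log_point_def height_def)
  then show ?thesis using dirichlet_poly_pos[OF f face_nonzero[OF i]] by (auto simp: knots_def)
qed

text \<open>\<open>supporting_face\<close> with threshold \<open>x\<close> gives a face with indices
  \<open>i\<close> and \<open>j\<close> such that \<open>i \<le> x < j\<close>. Since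
  \<open>j\<close> is itself a knot, the gap ends at or before it.\<close>

lemma gap_in_face:
  assumes f: "dirichlet_poly f" and nz: "f m \<noteq> 0" "f n \<noteq> 0"
    and mn: "\<And>i. f i \<noteq> 0 \<Longrightarrow> m \<le> i \<and> i \<le> n" and xy: "(x, y) \<in> gaps (knots p f)"
  obtains l where "Min (face p l f) \<le> x" "y \<le> Max (face p l f)"
proof -
  have "x \<in> knots p f" "y \<in> knots p f" "x < y" using xy by (auto simp: gaps_def)
  then have "m \<le> x" "x < n" using knots_bounds[OF f nz mn] by (blast, meson less_le_trans)
  then obtain l i j where ij: "i \<in> face p l f" "j \<in> face p l f" "i \<le> x" "x < j"
    using supporting_face[OF f nz(1) _ nz(2)] by metis
  have "y \<le> j" using xy knots_face[OF f ij(2)] ij(4) by (auto simp: gaps_def)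
  moreover have "Min (face p l f) \<le> i" "j \<le> Max (face p l f)" using ij finite_face[OF f] by auto
  ultimately show ?thesis using that ij by (meson order_trans)
qed

text \<open>Injectivity holds because the polygon is a graph over the abscissa. A knot strictly
  between the ends of a segment would be a log-integral point in its interior; conversely a gap lies
  within one edge, and a log-integral point inside the piece it cuts out would be a further
  knot.\<close>

lemma bij_betw_segments_gaps:
  assumes f: "dirichlet_poly f" and nz: "f m \<noteq> 0" "f n \<noteq> 0"
    and mn: "\<And>i. f i \<noteq> 0 \<Longrightarrow> m \<le> i \<and> i \<le> n"
  shows "bij_betw (map_prod fst fst) (newton_segments p f) (gaps (knots p f))"
proof (rule bij_betw_imageI)
  let ?L = "newton_log_polygon p f"
  have segL: "log_point P \<in> ?L" "log_point Q \<in> ?L" "0 < fst P" "fst P < fst Q"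
    if "(P, Q) \<in> newton_segments p f" for P Q
    using that by (auto simp: newton_segments_def polygon_edge_def)
  have same: "P = P'" if "log_point P \<in> ?L" "log_point P' \<in> ?L" "fst P = fst P'" for P P'
    using that polygon_unique[of "ln (real (fst P))" "real_of_int (snd P)" p f "real_of_int (snd P')"]
    by (simp add: log_point_def case_prod_beta prod_eq_iff)
  show "inj_on (map_prod fst fst) (newton_segments p f)"
  proof (rule inj_onI)
    fix z z' assume z: "z \<in> newton_segments p f" "z' \<in> newton_segments p f"
      and eq: "map_prod fst fst z = map_prod fst fst z'"
    obtain P Q P' Q' where PQ: "z = (P, Q)" "z' = (P', Q')" by (metis surj_pair)
    have "P = P'" "Q = Q'"
      using segL[OF z(1)[unfolded PQ]] segL[OF z(2)[unfolded PQ]] eq PQ by (auto intro!: same)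
    then show "z = z'" using PQ by simp
  qed
  show "map_prod fst fst ` newton_segments p f = gaps (knots p f)"
  proof (intro equalityI subsetI)
    fix z assume "z \<in> map_prod fst fst ` newton_segments p f"
    then obtain P Q where PQ: "(P, Q) \<in> newton_segments p f" and z: "z = (fst P, fst Q)" by auto
    note L = segL[OF PQ]
    obtain E where E: "polygon_edge ?L E" "log_point P \<in> E" "log_point Q \<in> E"
      and no: "open_segment (log_point P) (log_point Q) \<inter> log_integral_points = {}"
      using PQ by (auto simp: newton_segments_def)
    have segE: "closed_segment (log_point P) (log_point Q) \<subseteq> ?L"
      using E unfolding polygon_edge_def by (metis closed_segment_subset convex_closed_segment order_trans)
    have "\<not> (fst P < k \<and> k < fst Q)" if k: "k \<in> knots p f" for k
    proof
      assume lt: "fst P < k \<and> k < fst Q"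
      obtain u where u: "log_point (k, u) \<in> ?L" "0 < k" using k by (auto simp: knots_def)
      have "ln (real k) \<in> open_segment (ln (real (fst P))) (ln (real (fst Q)))"
        using lt L u by (simp add: open_segment_eq_real_ivl)
      then obtain w where w: "0 < w" "w < 1" "ln (real k) = (1 - w) * ln (real (fst P)) + w * ln (real (fst Q))"
        by (auto simp: in_segment)
      define y where "y = (1 - w) * real_of_int (snd P) + w * real_of_int (snd Q)"
      have ne: "log_point P \<noteq> log_point Q" using L by (auto simp: log_point_def case_prod_beta)
      \<comment> \<open>The interpolated ordinate \<open>y\<close> is a priori only real; as the
        segment lies in the polygon, it must agree with the integer ordinate \<open>u\<close> of the
        knot.\<close>
      have "(ln (real k), y) = (1 - w) *\<^sub>R log_point P + w *\<^sub>R log_point Q"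
        by (simp add: log_point_def case_prod_beta w(3) y_def)
      then have o: "(ln (real k), y) \<in> open_segment (log_point P) (log_point Q)"
        using w ne by (auto simp: in_segment)
      then have "(ln (real k), y) \<in> ?L" using segE segment_open_subset_closed by blast
      then have "y = real_of_int u" using polygon_unique u by (fastforce simp: log_point_def)
      then have "(ln (real k), y) \<in> log_integral_points"
        using u by (force simp: log_integral_points_def log_point_def)
      then show False using o no by blast
    qed
    moreover have "fst P \<in> knots p f" "fst Q \<in> knots p f"
      using L unfolding knots_def by (metis (mono_tags, lifting) mem_Collect_eq prod.collapse less_trans)+
    ultimately show "z \<in> gaps (knots p f)" using L z by (auto simp: gaps_def not_less)
  next
    fix z assume z: "z \<in> gaps (knots p f)"
    obtain x y where xy: "z = (x, y)" by (cases z)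
    obtain l where l: "Min (face p l f) \<le> x" "y \<le> Max (face p l f)"
      using gap_in_face[OF f nz mn z[unfolded xy]] .
    let ?i = "Min (face p l f)" and ?j = "Max (face p l f)"
    define E where "E = {(x, y). ln (real ?i) \<le> x \<and> x \<le> ln (real ?j) \<and> y = height p l f ?i + l * x}"
    have "face p l f \<noteq> {}" by (rule face_nonempty[OF f nz(1)])
    then have mem: "?i \<in> face p l f" "?j \<in> face p l f" using finite_face[OF f] by auto
    then have pos: "0 < ?i" "0 < ?j" using f face_nonzero dirichlet_poly_pos by blast+
    have xlty: "x < y" using z xy by (simp add: gaps_def)
    have edge: "polygon_edge ?L E"
      unfolding E_def by (rule polygon_edge_face[OF f nz(1)]) (use l xlty in simp)
    obtain u v where uv: "log_point (x, u) \<in> ?L" "log_point (y, v) \<in> ?L"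
      using z xy by (auto simp: gaps_def knots_def)
    have onE: "log_point (k, s) \<in> E" if "log_point (k, s) \<in> ?L" "?i \<le> k" "k \<le> ?j" for k s
    proof -
      have k: "ln (real ?i) \<le> ln (real k)" "ln (real k) \<le> ln (real ?j)" using that pos by auto
      from face_line_in_polygon[OF f mem this] that(1)
      have "real_of_int s = height p l f ?i + l * ln (real k)"
        by (auto simp: log_point_def intro: polygon_unique)
      then show ?thesis using k by (simp add: E_def log_point_def)
    qed
    have PE: "log_point (x, u) \<in> E" "log_point (y, v) \<in> E" using onE uv l xlty by auto
    have "open_segment (log_point (x, u)) (log_point (y, v)) \<inter> log_integral_points = {}"
    proof (rule ccontr)
      assume "\<not> ?thesis"
      then obtain k s where k: "0 < k" "log_point (k, s) \<in> open_segment (log_point (x, u)) (log_point (y, v))"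
        by (auto simp: log_integral_points_def)
      have "convex E" using edge by (auto simp: polygon_edge_def)
      then have "closed_segment (log_point (x, u)) (log_point (y, v)) \<subseteq> E"
        using PE by (simp add: closed_segment_subset)
      then have "log_point (k, s) \<in> ?L"
        using k segment_open_subset_closed edge unfolding polygon_edge_def by blast
      then have "k \<in> knots p f" using k by (auto simp: knots_def)
      moreover have "x < k \<and> k < y"
      proof -
        obtain w where w: "0 < w" "w < 1" "log_point (k, s) = (1 - w) *\<^sub>R log_point (x, u) + w *\<^sub>R log_point (y, v)"
          using k by (auto simp: in_segment)
        have "x > 0" using z xy by (auto simp: gaps_def knots_def)
        then have lnlt: "ln (real x) < ln (real y)" using xlty by simp
        have "ln (real k) = (1 - w) * ln (real x) + w * ln (real y)"
          using w(3) by (simp add: log_point_def)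
        then have "ln (real k) \<in> open_segment (ln (real x)) (ln (real y))"
          using w lnlt by (auto simp: in_segment)
        then show ?thesis using lnlt k xlty \<open>x > 0\<close> by (simp add: open_segment_eq_real_ivl)
      qed
      ultimately show False using z xy by (auto simp: gaps_def)
    qed
    then have "((x, u), (y, v)) \<in> newton_segments p f"
      using edge PE xlty z xy by (auto simp: newton_segments_def gaps_def knots_def)
    then show "z \<in> map_prod fst fst ` newton_segments p f" unfolding xy by force
  qed
qed

subsection \<open>Relative degree of a factor\<close>

text \<open>At the product of the extreme indices the Dirichlet sum has only one nonzero term, and a
  domain has no zero divisors.\<close>

lemma Min_Max_support_mult:
  fixes G H :: "nat \<Rightarrow> 'a::idom"
  assumes G: "dirichlet_poly G" "G \<noteq> (\<lambda>_. 0)" and H: "dirichlet_poly H" "H \<noteq> (\<lambda>_. 0)"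
  shows "dirichlet_mult G H (Min {i. G i \<noteq> 0} * Min {i. H i \<noteq> 0}) \<noteq> 0"
    and "dirichlet_mult G H (Max {i. G i \<noteq> 0} * Max {i. H i \<noteq> 0}) \<noteq> 0"
proof -
  let ?S = "{i. G i \<noteq> 0}" and ?T = "{i. H i \<noteq> 0}"
  have fin: "finite ?S" "finite ?T" using G H by (auto simp: dirichlet_poly_def)
  have ne: "?S \<noteq> {}" "?T \<noteq> {}" using G H by auto
  have nz: "G (Min ?S) \<noteq> 0" "G (Max ?S) \<noteq> 0" "H (Min ?T) \<noteq> 0" "H (Max ?T) \<noteq> 0"
    using Min_in[OF fin(1) ne(1)] Max_in[OF fin(1) ne(1)] Min_in[OF fin(2) ne(2)] Max_in[OF fin(2) ne(2)]
    by simp_all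
  have pos: "0 < j" if "G j \<noteq> 0 \<or> H j \<noteq> 0" for j
    using that dirichlet_poly_pos[OF G(1)] dirichlet_poly_pos[OF H(1)] by blast
  have "dirichlet_mult G H (Min ?S * Min ?T) = G (Min ?S) * H (Min ?T)"
  proof (rule dirichlet_mult_single)
    fix j k assume jk: "j * k = Min ?S * Min ?T" "G j \<noteq> 0" "H k \<noteq> 0"
    have "0 < Min ?S" "0 < Min ?T" "Min ?S \<le> j" "Min ?T \<le> k" using jk fin pos nz by simp_all
    then show "j = Min ?S \<and> k = Min ?T" using jk(1) by (rule mult_eq_min)
  qed (use pos nz in auto)
  then show "dirichlet_mult G H (Min ?S * Min ?T) \<noteq> 0" using nz by simp
  have "dirichlet_mult G H (Max ?S * Max ?T) = G (Max ?S) * H (Max ?T)"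
  proof (rule dirichlet_mult_single)
    fix j k assume jk: "j * k = Max ?S * Max ?T" "G j \<noteq> 0" "H k \<noteq> 0"
    have "0 < j" "0 < k" "j \<le> Max ?S" "k \<le> Max ?T" using jk fin pos by simp_all
    then show "j = Max ?S \<and> k = Max ?T" using jk(1) by (rule mult_eq_max)
  qed (use pos nz in auto)
  then show "dirichlet_mult G H (Max ?S * Max ?T) \<noteq> 0" using nz by simp
qed

lemma mult_eq_bounds:
  fixes a b A B :: nat
  assumes "0 < A" "0 < B" "A \<le> a" "B \<le> b" "a * b = A * B"
  shows "a = A" "b = B"
  using mult_eq_min[OF assms] by auto

text \<open>A function \<open>\<alpha>\<close> on the knots tracks the share of the factor
  \<open>G\<close>. It runs from \<open>c\<close> at \<open>m\<close> to \<open>d\<close> at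
  \<open>n\<close>, and across each segment it either stays constant or is multiplied by the
  relative degree. Telescoping over the gaps gives the product.\<close>

lemma factor_ratio_is_product:
  fixes f G H :: "nat \<Rightarrow> 'a::{factorial_semiring, idom}"
  assumes p: "prime_elem p" and f: "dirichlet_poly f"
    and G: "dirichlet_poly G" "G \<noteq> (\<lambda>_. 0)" and H: "dirichlet_poly H" "H \<noteq> (\<lambda>_. 0)"
    and r: "r \<noteq> 0" and eq: "(\<lambda>i. r * f i) = dirichlet_mult G H"
    and nz: "f m \<noteq> 0" "f n \<noteq> 0" and mn: "\<And>i. f i \<noteq> 0 \<Longrightarrow> m \<le> i \<and> i \<le> n" and "m < n"
    and c: "c = Min {i. G i \<noteq> 0}" and d: "d = Max {i. G i \<noteq> 0}"
    and m: "m = c * Min {i. H i \<noteq> 0}" and n: "n = d * Max {i. H i \<noteq> 0}"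
  shows "\<exists>e :: _ \<Rightarrow> nat. range e \<subseteq> {0, 1} \<and>
    real d / real c = (\<Prod>s\<in>newton_segments p f. relative_degree s ^ e s)"
proof -
  define If Jf IG JG IH JH where
    "If = (\<lambda>l. Min (face p l f))" and "Jf = (\<lambda>l. Max (face p l f))" and
    "IG = (\<lambda>l. Min (face p l G))" and "JG = (\<lambda>l. Max (face p l G))" and
    "IH = (\<lambda>l. Min (face p l H))" and "JH = (\<lambda>l. Max (face p l H))"
  note defs = If_def Jf_def IG_def JG_def IH_def JH_def
  obtain g0 h0 where gh0: "G g0 \<noteq> 0" "H h0 \<noteq> 0" using G(2) H(2) unfolding fun_eq_iff by blast
  have mem: "If l \<in> face p l f" "Jf l \<in> face p l f" "IG l \<in> face p l G" "JG l \<in> face p l G"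
    "IH l \<in> face p l H" "JH l \<in> face p l H" for l
    unfolding defs
    using finite_face[OF f] finite_face[OF G(1)] finite_face[OF H(1)]
      face_nonempty[OF f nz(1)] face_nonempty[OF G(1) gh0(1)] face_nonempty[OF H(1) gh0(2)]
    by (auto intro!: Min_in Max_in)
  note supp = mem[THEN face_nonzero]
  have pos: "0 < If l" "0 < Jf l" "0 < IG l" "0 < JG l" "0 < IH l" "0 < JH l" for l
    using dirichlet_poly_pos[OF f] dirichlet_poly_pos[OF G(1)] dirichlet_poly_pos[OF H(1)] supp by blast+
  have le: "IG l \<le> JG l" "IH l \<le> JH l" for l
    unfolding defs using mem(3-6)[of l, unfolded defs] finite_face[OF G(1)] finite_face[OF H(1)] by auto
  have I: "If l = IG l * IH l" and J: "Jf l = JG l * JH l" for l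
    unfolding defs
    using Min_face_mult[OF p G H, of l] Max_face_mult[OF p G H, of l] face_scale[OF p r, of l f]
    unfolding eq by auto
  have ht: "real (multiplicity p r) + height p l f (If l) = height p l G (IG l) + height p l H (IH l)" for l
    using Min_height_mult[OF p G H, of l] height_scale[where f = f and i = "If l" and l = l, OF p r supp(1)]
      face_scale[OF p r, of l f]
    unfolding eq defs by simp
  \<comment> \<open>By \<open>face_mono\<close> each factor can only move to the right between the
    two slopes. Equality of the products therefore leaves no room for either to move.\<close>
  have step: "JG l = IG l'" "JH l = IH l'" if "l < l'" "Jf l = If l'" for l l'
  proof -
    have "IG l' * IH l' = JG l * JH l" using that(2) unfolding I J by simp
    from mult_eq_bounds[OF pos(4) pos(6) face_mono[OF G(1) that(1) mem(4) mem(3)]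
      face_mono[OF H(1) that(1) mem(6) mem(5)] this]
    show "JG l = IG l'" "JH l = IH l'" by simp_all
  qed
  define supporting where "supporting = (\<lambda>x l. If l \<le> x \<and> x \<le> Jf l)"
  \<comment> \<open>While \<open>G\<close> is traversed, \<open>H\<close> stays at
    \<open>IH l\<close>, so the share of \<open>G\<close> is the quotient; once it reaches
    \<open>JG l\<close>, only \<open>H\<close> moves on.\<close>
  define A where "A = (\<lambda>x l. min (real x / real (IH l)) (real (JG l)))"
  \<comment> \<open>The part of \<open>x\<close> contributed by \<open>G\<close>: along a face, the polygon of \<open>f\<close> is traversed as the
    translated face of \<open>G\<close> followed by that of \<open>H\<close>, and the index \<open>JG l * IH l\<close> between the two
    is a log-integral point.\<close>
  define \<alpha> where "\<alpha> = (\<lambda>x. A x (SOME l. supporting x l))"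
  \<comment> \<open>Two slopes can support the same \<open>x\<close> only at a common vertex. There
    \<open>step\<close> matches the final value of one face with the initial value of the other, so
    the choice made in \<open>\<alpha>\<close> is immaterial.\<close>
  have A_less: "A x l = A x l'" if "supporting x l" "supporting x l'" "l < l'" for x l l'
  proof -
    have "Jf l \<le> If l'" using face_mono[OF f that(3) mem(2) mem(1)] .
    then have x: "x = Jf l" "Jf l = If l'" using that by (auto simp: supporting_def)
    have "A x l = real (JG l)"
    proof -
      have "real (JG l) * real (IH l) \<le> real x"
        using le(2)[of l] unfolding x(1) J by (simp add: mult_left_mono)
      then show ?thesis using pos(5)[of l] by (simp add: A_def min_def pos_le_divide_eq) (simp add: field_simps)
    qed
    moreover have "A x l' = real (IG l')"
    proof -
      have "real x / real (IH l') = real (IG l')" using pos(5)[of l'] by (simp add: x I)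
      then show ?thesis using le(1)[of l'] by (simp add: A_def)
    qed
    ultimately show ?thesis using step[OF that(3) x(2)] by simp
  qed
  have \<alpha>: "\<alpha> x = A x l" if "supporting x l" for x l
  proof -
    have "supporting x (SOME l. supporting x l)" using that by (rule someI)
    then show ?thesis unfolding \<alpha>_def using A_less that by (metis linorder_neqE)
  qed
  \<comment> \<open>The index need not belong to the support of \<open>f\<close>. Its point on the
    supporting line still has integer ordinate: the sum of two valuations minus that of
    \<open>r\<close>.\<close>
  have knot: "JG l * IH l \<in> knots p f" for l
  proof -
    let ?t = "JG l * IH l"
    have "If l \<le> ?t" "?t \<le> Jf l" unfolding I J using le by simp_all
    then have "ln (real (If l)) \<le> ln (real ?t)" "ln (real ?t) \<le> ln (real (Jf l))"
      using pos[of l] by (simp_all del: of_nat_mult)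
    then have "(ln (real ?t), height p l f (If l) + l * ln (real ?t)) \<in> newton_log_polygon p f"
      by (rule face_line_in_polygon[OF f mem(1,2)])
    moreover have "height p l f (If l) + l * ln (real ?t) =
      real_of_int (int (multiplicity p (G (JG l))) + int (multiplicity p (H (IH l))) - int (multiplicity p r))"
    proof -
      have "height p l f (If l) = height p l G (JG l) + height p l H (IH l) - real (multiplicity p r)"
        using ht[of l] face_height_eq[OF mem(3,4), of l] by simp
      then show ?thesis
        unfolding height_mult_ln[OF pos(4,5)] by simp
    qed
    ultimately have "log_point (?t, int (multiplicity p (G (JG l))) + int (multiplicity p (H (IH l))) -
        int (multiplicity p r)) \<in> newton_log_polygon p f"
      by (simp only: log_point_def case_prod_conv)
    moreover have "0 < ?t" using pos(4,5)[of l] by simp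
    ultimately show ?thesis unfolding knots_def by blast
  qed
  have finK: "finite (knots p f)"
    by (rule finite_subset[of _ "{..n}"]) (use knots_bounds[OF f nz mn] in auto)
  obtain lm i j where lm: "i \<in> face p lm f" "j \<in> face p lm f" "i \<le> m" "m < j"
    using supporting_face[OF f nz(1) le_refl nz(2) \<open>m < n\<close>] .
  \<comment> \<open>With threshold \<open>n - 1\<close> the index above the threshold can only be
    \<open>n\<close>, just as threshold \<open>m\<close> forces the lower index to be
    \<open>m\<close>.\<close>
  have n1: "m \<le> n - 1" "n - 1 < n" using \<open>m < n\<close> by simp_all
  obtain ln' i' j' where ln': "i' \<in> face p ln' f" "j' \<in> face p ln' f" "i' \<le> n - 1" "n - 1 < j'"
    using supporting_face[OF f nz(1) n1(1) nz(2) n1(2)] .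
  have "i = m" using lm(3) mn[OF face_nonzero[OF lm(1)]] by simp
  then have mf: "m \<in> face p lm f" using lm(1) by simp
  have "j' = n" using ln'(4) mn[OF face_nonzero[OF ln'(2)]] by linarith
  then have nf: "n \<in> face p ln' f" using ln'(2) by simp
  have Im: "If lm = m" and Jn: "Jf ln' = n"
    unfolding If_def Jf_def
    by (rule Min_eqI[OF finite_face[OF f] _ mf], use mn face_nonzero in blast,
        rule Max_eqI[OF finite_face[OF f] _ nf], use mn face_nonzero in blast)
  have finS: "finite {i. G i \<noteq> 0}" "finite {i. H i \<noteq> 0}" using G H by (auto simp: dirichlet_poly_def)
  have posm: "0 < m" "0 < n" using dirichlet_poly_pos[OF f] nz by auto
  have cd: "0 < c" "0 < Min {i. H i \<noteq> 0}" using posm m by simp_all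
  \<comment> \<open>The face indices of \<open>G\<close> and \<open>H\<close> have the same product
    as the extremes of their supports and are bounded by them, so they coincide; \<open>JGn\<close>
    uses the same argument at the other end.\<close>
  have IGm: "IG lm = c"
  proof (rule mult_eq_bounds(1)[OF cd])
    show "c \<le> IG lm" "Min {i. H i \<noteq> 0} \<le> IH lm" using c finS supp by simp_all
    show "IG lm * IH lm = c * Min {i. H i \<noteq> 0}" using Im I m by simp
  qed
  have JGn: "JG ln' = d"
  proof (rule mult_eq_bounds(1)[OF pos(4) pos(6), symmetric])
    show "JG ln' \<le> d" "JH ln' \<le> Max {i. H i \<noteq> 0}" using d finS supp by simp_all
    show "d * Max {i. H i \<noteq> 0} = JG ln' * JH ln'" using Jn J n by simp
  qed
  have le_mm: "supporting m lm" "supporting n ln'"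
    using Im Jn mf nf finite_face[OF f] unfolding supporting_def If_def Jf_def by auto
  have \<alpha>m: "\<alpha> m = real c"
    using \<alpha>[OF le_mm(1)] pos(5)[of lm] le(1)[of lm] I[of lm] Im by (simp add: A_def IGm[symmetric])
  have \<alpha>n: "\<alpha> n = real d"
  proof -
    have "real (JG ln') * real (IH ln') \<le> real n"
      using le(2)[of ln'] unfolding Jn[symmetric] J by (simp add: mult_left_mono)
    then have "real (JG ln') \<le> real n / real (IH ln')" using pos(5)[of ln'] by (simp add: pos_le_divide_eq)
    then show ?thesis using \<alpha>[OF le_mm(2)] by (simp add: A_def JGn)
  qed
  have gap: "\<exists>l. supporting x l \<and> supporting y l" if g: "(x, y) \<in> gaps (knots p f)" for x y
  proof -
    obtain l where "If l \<le> x" "y \<le> Jf l"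
      using gap_in_face[OF f nz mn g] unfolding If_def Jf_def by metis
    then show ?thesis using g by (auto simp: supporting_def gaps_def)
  qed
  have mK: "m \<in> knots p f" "n \<in> knots p f" using knots_face[OF f] mf nf by blast+
  have \<alpha>_nz: "\<alpha> x \<noteq> 0" if x: "x \<in> knots p f" for x
  proof -
    have x0: "0 < x" using x by (simp add: knots_def)
    have "0 < A x l" for l using x0 pos(4,5)[of l] by (simp add: A_def)
    then show ?thesis by (metis \<alpha>_def less_irrefl)
  qed
  \<comment> \<open>The transition index \<open>?t\<close> is a knot, so no gap straddles it: after
    it \<open>\<alpha>\<close> is constant, before it \<open>\<alpha>\<close> is proportional to the
    index.\<close>
  have dich: "\<alpha> y / \<alpha> x \<in> {1, real y / real x}" if g: "(x, y) \<in> gaps (knots p f)" for x y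
  proof -
    obtain l where l: "supporting x l" "supporting y l" using gap[OF g] by blast
    let ?t = "JG l * IH l"
    have xy: "0 < x" "x < y" "x \<in> knots p f" using g by (auto simp: gaps_def knots_def)
    have IHpos: "0 < real (IH l)" using pos(5)[of l] by simp
    consider "?t \<le> x" | "y \<le> ?t" using g knot[of l] by (auto simp: gaps_def)
    then show ?thesis
    proof cases
      case 1
      have "A z l = real (JG l)" if "?t \<le> z" for z
      proof -
        have "real (JG l) * real (IH l) \<le> real z" using that by (metis of_nat_le_iff of_nat_mult)
        then show ?thesis using IHpos by (simp add: A_def min_absorb2 pos_le_divide_eq)
      qed
      then have "\<alpha> y = \<alpha> x" using 1 xy \<alpha>[OF l(1)] \<alpha>[OF l(2)] by simp
      then show ?thesis using \<alpha>_nz[OF xy(3)] by simp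
    next
      case 2
      have "A z l = real z / real (IH l)" if "z \<le> ?t" for z
      proof -
        have "real z \<le> real (JG l) * real (IH l)" using that by (metis of_nat_le_iff of_nat_mult)
        then show ?thesis using IHpos by (simp add: A_def min_absorb1 pos_divide_le_eq)
      qed
      then have "\<alpha> y = real y / real (IH l)" "\<alpha> x = real x / real (IH l)"
        using 2 xy \<alpha>[OF l(1)] \<alpha>[OF l(2)] by simp_all
      then show ?thesis using IHpos by simp
    qed
  qed
  \<comment> \<open>Exponent 1 selects the segments coming from \<open>G\<close>, exponent 0 those
    coming from \<open>H\<close>.\<close>
  define e :: "(nat \<times> int) \<times> (nat \<times> int) \<Rightarrow> nat"
    where "e = (\<lambda>(P, Q). if \<alpha> (fst Q) / \<alpha> (fst P) = 1 then 0 else 1)"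
  have bij: "bij_betw (map_prod fst fst) (newton_segments p f) (gaps (knots p f))"
    by (rule bij_betw_segments_gaps[OF f nz mn])
  have "real d / real c = \<alpha> (Max (knots p f)) / \<alpha> (Min (knots p f))"
  proof -
    have "Max (knots p f) = n" "Min (knots p f) = m"
      using mK finK knots_bounds[OF f nz mn] by (auto intro!: Max_eqI Min_eqI)
    then show ?thesis using \<alpha>m \<alpha>n by simp
  qed
  also have "\<dots> = (\<Prod>(x, y)\<in>gaps (knots p f). \<alpha> y / \<alpha> x)"
  proof (rule prod_gaps[symmetric])
    show "knots p f \<noteq> {}" using mK by blast
  qed (use finK \<alpha>_nz in auto)
  also have "\<dots> = (\<Prod>s\<in>newton_segments p f. case map_prod fst fst s of (x, y) \<Rightarrow> \<alpha> y / \<alpha> x)"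
    by (rule prod.reindex_bij_betw[OF bij, symmetric])
  also have "\<dots> = (\<Prod>s\<in>newton_segments p f. relative_degree s ^ e s)"
  proof (rule prod.cong[OF refl])
    fix s assume s: "s \<in> newton_segments p f"
    obtain P Q where PQ: "s = (P, Q)" by (cases s)
    have "(fst P, fst Q) \<in> gaps (knots p f)" using bij_betw_apply[OF bij s] PQ by simp
    from dich[OF this] show "(case map_prod fst fst s of (x, y) \<Rightarrow> \<alpha> y / \<alpha> x) = relative_degree s ^ e s"
      by (auto simp: PQ e_def relative_degree_def case_prod_beta)
  qed
  finally have "real d / real c = (\<Prod>s\<in>newton_segments p f. relative_degree s ^ e s)" .
  moreover have "range e \<subseteq> {0, 1}" by (auto simp: e_def)
  ultimately show ?thesis by blast
qed

text \<open>The products of the extremes bound the support of \<open>f\<close> and belong to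
  it.\<close>

lemma support_extremes_mult:
  fixes f G H :: "nat \<Rightarrow> 'a::idom"
  assumes G: "dirichlet_poly G" "G \<noteq> (\<lambda>_. 0)" and H: "dirichlet_poly H" "H \<noteq> (\<lambda>_. 0)"
    and r: "r \<noteq> 0" and eq: "(\<lambda>i. r * f i) = dirichlet_mult G H"
    and nz: "f m \<noteq> 0" "f n \<noteq> 0" and mn: "\<And>i. f i \<noteq> 0 \<Longrightarrow> m \<le> i \<and> i \<le> n"
  shows "m = Min {i. G i \<noteq> 0} * Min {i. H i \<noteq> 0}" "n = Max {i. G i \<noteq> 0} * Max {i. H i \<noteq> 0}"
proof -
  let ?S = "{i. G i \<noteq> 0}" and ?T = "{i. H i \<noteq> 0}"
  have fin: "finite ?S" "finite ?T" using G H by (auto simp: dirichlet_poly_def)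
  have f_iff: "f i \<noteq> 0 \<longleftrightarrow> dirichlet_mult G H i \<noteq> 0" for i
    using fun_cong[OF eq, of i] r by (metis mult_eq_0_iff)
  have bounds: "Min ?S * Min ?T \<le> i \<and> i \<le> Max ?S * Max ?T" if i: "f i \<noteq> 0" for i
  proof -
    obtain j k where jk: "j * k = i" "G j \<noteq> 0" "H k \<noteq> 0"
      using dirichlet_mult_nonzeroE[OF i[unfolded f_iff]] by metis
    then show ?thesis using fin unfolding jk(1)[symmetric] by (simp add: mult_le_mono)
  qed
  have ext: "f (Min ?S * Min ?T) \<noteq> 0" "f (Max ?S * Max ?T) \<noteq> 0"
    unfolding f_iff by (rule Min_Max_support_mult[OF G H])+
  show "m = Min ?S * Min ?T" "n = Max ?S * Max ?T"
    using bounds[OF nz(1)] bounds[OF nz(2)] mn[OF ext(1)] mn[OF ext(2)] by (blast intro: le_antisym)+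
qed

text \<open>If \<open>G\<close> had a single index in its support, that index would divide the whole
  support of \<open>f\<close>; primitivity makes it 1, so \<open>G\<close> would be
  constant.\<close>

lemma factor_support_spread:
  fixes f G H :: "nat \<Rightarrow> 'a::idom"
  assumes G: "dirichlet_poly G" "\<not> dirichlet_const G"
    and r: "r \<noteq> 0" and eq: "(\<lambda>i. r * f i) = dirichlet_mult G H"
    and prim: "algebraically_primitive f"
  shows "Min {i. G i \<noteq> 0} < Max {i. G i \<noteq> 0}"
proof (rule ccontr)
  let ?S = "{i. G i \<noteq> 0}"
  assume no: "\<not> ?thesis"
  have fin: "finite ?S" using G by (simp add: dirichlet_poly_def)
  have single: "j = Min ?S" if "G j \<noteq> 0" for j
    using no Min_le[OF fin, of j] Max_ge[OF fin, of j] that by simp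
  have "Min ?S dvd i" if "f i \<noteq> 0" for i
  proof -
    have "dirichlet_mult G H i \<noteq> 0" using fun_cong[OF eq, of i] r that by (metis mult_eq_0_iff)
    then obtain j k where "j * k = i" "G j \<noteq> 0" by (rule dirichlet_mult_nonzeroE)
    then show ?thesis using single by (metis dvd_triv_left)
  qed
  then have "Min ?S dvd Gcd {i. f i \<noteq> 0}" by (intro Gcd_greatest) simp
  then have "Min ?S = 1" using prim by (simp add: algebraically_primitive_def)
  then have "dirichlet_const G" using single by (auto simp: dirichlet_const_def)
  then show False using G by simp
qed

text \<open>The extremes of a factor divide those of \<open>f\<close>, which gives membership in
  \<open>S1_rd\<close>; \<open>factor_ratio_is_product\<close> supplies the representation by
  segments.\<close>

lemma factor_ratio_in_S_prime:
  fixes f G H :: "nat \<Rightarrow> 'a::{factorial_semiring, idom}"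
  assumes p: "prime_elem p" and f: "dirichlet_poly f"
    and G: "dirichlet_poly G" "G \<noteq> (\<lambda>_. 0)" and H: "dirichlet_poly H" "H \<noteq> (\<lambda>_. 0)"
    and r: "r \<noteq> 0" and eq: "(\<lambda>i. r * f i) = dirichlet_mult G H"
    and nz: "f m \<noteq> 0" "f n \<noteq> 0" and mn: "\<And>i. f i \<noteq> 0 \<Longrightarrow> m \<le> i \<and> i \<le> n"
    and c: "c = Min {i. G i \<noteq> 0}" and d: "d = Max {i. G i \<noteq> 0}" and "c < d"
    and le: "real d / real c \<le> sqrt (real n / real m)"
  shows "real d / real c \<in> S_prime p f m n"
proof -
  have ext: "m = c * Min {i. H i \<noteq> 0}" "n = d * Max {i. H i \<noteq> 0}"
    unfolding c d by (rule support_extremes_mult[OF G H r eq nz mn], assumption)+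
  have pos: "0 < m" using dirichlet_poly_pos[OF f nz(1)] .
  then have c0: "0 < c" "0 < Min {i. H i \<noteq> 0}" unfolding ext(1) by simp_all
  have fin: "finite {i. H i \<noteq> 0}" "{i. H i \<noteq> 0} \<noteq> {}" using H by (auto simp: dirichlet_poly_def)
  have "Min {i. H i \<noteq> 0} \<le> Max {i. H i \<noteq> 0}" by (rule Max_ge[OF fin(1) Min_in[OF fin]])
  then have "m < n"
    using \<open>c < d\<close> c0 unfolding ext by (intro mult_less_le_imp_less) auto
  have "d dvd n" "c dvd m" unfolding ext by simp_all
  moreover have "1 < real d / real c" using c0 \<open>c < d\<close> by simp
  ultimately have "real d / real c \<in> S1_rd m n" using le unfolding S1_rd_def by blast
  moreover have "\<exists>e :: _ \<Rightarrow> nat. range e \<subseteq> {0, 1} \<and>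
      real d / real c = (\<Prod>s\<in>newton_segments p f. relative_degree s ^ e s)"
    by (rule factor_ratio_is_product[OF p f G H r eq nz mn \<open>m < n\<close> c d ext])
  ultimately show ?thesis unfolding S_prime_def by blast
qed

section \<open>Descent from the quotient field to the domain, and conclusion\<close>

lemma clear_denominators:
  fixes g :: "nat \<Rightarrow> 'a::idom fract"
  assumes "dirichlet_poly g"
  obtains r G where "r \<noteq> 0" "dirichlet_poly G" "\<And>i. to_fract (G i) = to_fract r * g i"
proof -
  \<comment> \<open>A common denominator is built up over the finite support, one denominator
    \<open>b\<close> being multiplied in for each new index.\<close>
  have "\<exists>r. r \<noteq> 0 \<and> (\<forall>i\<in>S. \<exists>a. to_fract r * g i = to_fract a)" if "finite S" for S
    using that
  proof induction
    case empty
    show ?case by (auto intro: exI[of _ 1])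
  next
    case (insert x S)
    then obtain r where r: "r \<noteq> 0" "\<forall>i\<in>S. \<exists>a. to_fract r * g i = to_fract a" by blast
    obtain a b where ab: "g x = Fract a b" "b \<noteq> 0" by (cases "g x")
    have "to_fract b * g x = to_fract a"
      using ab by (simp add: Fract_conv_to_fract)
    moreover have "to_fract (b * r) * g x = to_fract r * (to_fract b * g x)"
      by (simp only: to_fract_mult mult_ac)
    ultimately have "to_fract (b * r) * g x = to_fract (r * a)" by simp
    moreover have "\<exists>a. to_fract (b * r) * g i = to_fract a" if "i \<in> S" for i
    proof -
      from bspec[OF r(2) that] obtain a where "to_fract r * g i = to_fract a" ..
      moreover have "to_fract (b * r) * g i = to_fract b * (to_fract r * g i)"
        by (simp only: to_fract_mult mult_ac)
      ultimately have "to_fract (b * r) * g i = to_fract (b * a)" by simp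
      then show ?thesis by blast
    qed
    moreover have "b * r \<noteq> 0" using r ab by simp
    ultimately show ?case by blast
  qed
  moreover have "finite {i. g i \<noteq> 0}" using assms by (simp add: dirichlet_poly_def)
  ultimately obtain r where r: "r \<noteq> 0" "\<forall>i\<in>{i. g i \<noteq> 0}. \<exists>a. to_fract r * g i = to_fract a"
    by blast
  have "\<exists>a. to_fract a = to_fract r * g i" for i
  proof (cases "g i = 0")
    case True
    then show ?thesis by (auto intro: exI[of _ 0])
  next
    case False
    then have "i \<in> {i. g i \<noteq> 0}" by simp
    from bspec[OF r(2) this] obtain a where "to_fract r * g i = to_fract a" ..
    then show ?thesis by (intro exI[of _ a]) (rule sym)
  qed
  then have "\<exists>G. \<forall>i. to_fract (G i) = to_fract r * g i" by (intro choice) blast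
  then obtain G where G: "\<And>i. to_fract (G i) = to_fract r * g i" by blast
  have iff: "G i = 0 \<longleftrightarrow> g i = 0" for i
    using r(1) arg_cong[OF G[of i], of "\<lambda>x. x = 0"] by simp
  have "dirichlet_poly G" using assms by (simp add: dirichlet_poly_def iff)
  then show ?thesis using that r(1) G by blast
qed

theorem theorem5p1:
  fixes f :: "nat \<Rightarrow> 'a::{factorial_semiring, idom}"
    and m n k :: nat
    and p :: "nat \<Rightarrow> 'a"
  assumes "dirichlet_poly f"
    and "algebraically_primitive f"
    and "f m \<noteq> 0" and "f n \<noteq> 0"
    and "\<And>i. f i \<noteq> 0 \<Longrightarrow> m \<le> i \<and> i \<le> n"
    and "k \<ge> 1"
    and "\<And>i. i \<in> {1..k} \<Longrightarrow> prime_elem (p i)"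
    and "(\<Inter>i\<in>{1..k}. S_prime (p i) f m n) = {}"
  shows "dirichlet_irreducible (\<lambda>i. to_fract (f i))"
  unfolding dirichlet_irreducible_def
proof
  note f = assms(1) and prim = assms(2) and nz = assms(3,4) and mn = assms(5)
  assume "\<exists>g h. dirichlet_poly g \<and> dirichlet_poly h \<and> \<not> dirichlet_const g \<and> \<not> dirichlet_const h \<and>
    (\<lambda>i. to_fract (f i)) = dirichlet_mult g h"
  then obtain g h where gh: "dirichlet_poly g" "dirichlet_poly h" "\<not> dirichlet_const g" "\<not> dirichlet_const h"
    and fgh: "(\<lambda>i. to_fract (f i)) = dirichlet_mult g h" by blast
  obtain r G where G: "r \<noteq> 0" "dirichlet_poly G" "\<And>i. to_fract (G i) = to_fract r * g i"
    using clear_denominators[OF gh(1)] by metis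
  obtain s H where H: "s \<noteq> 0" "dirichlet_poly H" "\<And>i. to_fract (H i) = to_fract s * h i"
    using clear_denominators[OF gh(2)] by metis
  have rs: "r * s \<noteq> 0" using G H by simp
  \<comment> \<open>Over the domain the factorisation holds up to the nonzero scalar
    \<open>r * s\<close>, which changes neither the support nor the faces.\<close>
  have eq: "(\<lambda>i. r * s * f i) = dirichlet_mult G H"
  proof
    fix i
    have "to_fract (r * s * f i) = to_fract r * to_fract s * dirichlet_mult g h i"
      using fun_cong[OF fgh, of i] by simp
    also have "\<dots> = to_fract (dirichlet_mult G H i)"
      unfolding dirichlet_mult_def
      by (simp add: sum_distrib_left case_prod_beta G(3) H(3) mult_ac)
    finally show "r * s * f i = dirichlet_mult G H i" by (simp only: to_fract_eq_iff)
  qed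
  have eq': "(\<lambda>i. r * s * f i) = dirichlet_mult H G" using eq dirichlet_mult_commute[of G H] by simp
  have "G i = 0 \<longleftrightarrow> g i = 0" "H i = 0 \<longleftrightarrow> h i = 0" for i
    using G(1) H(1) arg_cong[OF G(3)[of i], of "\<lambda>x. x = 0"] arg_cong[OF H(3)[of i], of "\<lambda>x. x = 0"]
    by simp_all
  then have nconst: "\<not> dirichlet_const G" "\<not> dirichlet_const H"
    using gh(3,4) by (simp_all add: dirichlet_const_def)
  then have G0: "G \<noteq> (\<lambda>_. 0)" and H0: "H \<noteq> (\<lambda>_. 0)" by (auto simp: dirichlet_const_def)
  define c d c' d' where "c = Min {i. G i \<noteq> 0}" and "d = Max {i. G i \<noteq> 0}"
    and "c' = Min {i. H i \<noteq> 0}" and "d' = Max {i. H i \<noteq> 0}"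
  note cd = c_def d_def c'_def d'_def
  have lt: "c < d" "c' < d'"
    unfolding cd
    using factor_support_spread[OF G(2) nconst(1) rs eq prim]
      factor_support_spread[OF H(2) nconst(2) rs eq' prim] by simp_all
  have prod: "m = c * c'" "n = d * d'"
    unfolding cd by (rule support_extremes_mult[OF G(2) G0 H(2) H0 rs eq nz mn], assumption)+
  have ratio: "real n / real m = (real d / real c) * (real d' / real c')" by (simp add: prod)
  \<comment> \<open>The two ratios multiply to \<open>n / m\<close>, so the smaller is at most its
    square root. It depends only on the factors and not on the prime, hence it lies in all the sets
    at once.\<close>
  have "\<exists>q. \<forall>i\<in>{1..k}. q \<in> S_prime (p i) f m n"
  proof (cases "real d / real c \<le> real d' / real c'")
    case True
    then have "(real d / real c)\<^sup>2 \<le> real n / real m"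
      unfolding ratio power2_eq_square by (intro mult_left_mono) auto
    then have "real d / real c \<le> sqrt (real n / real m)" by (rule real_le_rsqrt)
    then show ?thesis
      using factor_ratio_in_S_prime[OF assms(7) f G(2) G0 H(2) H0 rs eq nz mn c_def d_def lt(1)] by blast
  next
    case False
    then have "(real d' / real c')\<^sup>2 \<le> real n / real m"
      unfolding ratio power2_eq_square by (intro mult_right_mono) auto
    then have "real d' / real c' \<le> sqrt (real n / real m)" by (rule real_le_rsqrt)
    then show ?thesis
      using factor_ratio_in_S_prime[OF assms(7) f H(2) H0 G(2) G0 rs eq' nz mn c'_def d'_def lt(2)] by blast
  qed
  then show False using assms(8) by blast
qed

end
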